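(* Let $(M,g)$ be an $n$-dimensional $(N(k),\xi)$-semi-Riemannian manifold, let $a_0,\dots,a_7,b_0,\dots,b_7$ be real numbers, and suppose $M$ is $(\mathcal{T}_a,\mathcal{T}_b)$-pseudosymmetric, i.e. $\mathcal{T}_a\cdot\mathcal{T}_b=L_g\,Q(g,\mathcal{T}_b)$ for a smooth function $L_g$ on $M$. Then for all vector fields $U,V,W,X$ on $M$: \begin{align*} &\varepsilon b_0(ka_0+k(n-1)a_4+a_7r)R(U,V,W,X)+\varepsilon a_1b_0S(X,R(U,V)W)\\ &-2k(n-1)a_3(kb_0+k(n-1)b_4+b_7r)\eta(X)\eta(U)g(V,W)\\ &-2k(n-1)a_3(-kb_0+k(n-1)b_5-b_7r)\eta(X)\eta(V)g(U,W)\\ &+\varepsilon a_1b_4S^2(X,U)g(V,W)+\varepsilon a_1b_5S^2(X,V)g(U,W)+\varepsilon a_1b_6S^2(X,W)g(U,V)\\ &-a_5(b_1+b_3)S^2(X,V)\eta(U)\eta(W)-a_5(b_1+b_2)S^2(X,W)\eta(U)\eta(V)-a_5(b_2+b_3)S^2(X,U)\eta(V)\eta(W)\\ &-2a_6b_1S^2(V,W)\eta(X)\eta(U)-2a_6b_2S^2(U,W)\eta(X)\eta(V)-2a_6b_3S^2(U,V)\eta(X)\eta(W)\\ &-2k^2(n-1)^2a_3b_6\,g(U,V)\eta(X)\eta(W)\\ &-2\big(k(n-1)a_3b_1+a_6(kb_0+k(n-1)b_4+b_7r)\big)\eta(X)\eta(U)S(V,W)\\ &-2\big(k(n-1)a_3b_2+a_6(-kb_0+k(n-1)b_5-b_7r)\big)\eta(X)\eta(V)S(U,W)\\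 &-2k(n-1)(a_3b_3+a_6b_6)S(U,V)\eta(X)\eta(W)\\ &+\varepsilon\big(b_4(ka_0+k(n-1)a_4+a_7r)-a_1(kb_0+k(n-1)b_4)\big)S(X,U)g(V,W)\\ &+\varepsilon\big(b_5(ka_0+k(n-1)a_4+a_7r)-a_1(-kb_0+k(n-1)b_5)\big)S(X,V)g(U,W)\\ &+\varepsilon b_6(ka_0+k(n-1)(a_4-a_1)+a_7r)S(X,W)g(U,V)\\ &-\varepsilon(kb_0+k(n-1)b_4)(ka_0+k(n-1)a_4+a_7r)g(X,U)g(V,W)\\ &-\varepsilon(-kb_0+k(n-1)b_5)(ka_0+k(n-1)a_4+a_7r)g(U,W)g(X,V)\\ &-\varepsilon k(n-1)b_6(ka_0+k(n-1)a_4+a_7r)g(X,W)g(U,V)\\ &-k(n-1)\big((b_2+b_3)(ka_0+k(n-1)a_4+a_7r)+(a_2+a_4)(-kb_0+k(n-1)(b_5+b_6)-b_7r)\big)g(X,U)\eta(V)\eta(W)\\ &-k(n-1)\big((b_1+b_3)(ka_0+k(n-1)a_4+a_7r)+(a_2+a_4)(kb_0+k(n-1)(b_4+b_6)+b_7r)\big)g(X,V)\eta(U)\eta(W)\\ &-\big((b_1+b_3)(-ka_0+k(n-1)(a_1+a_2)-a_7r)+(a_1+a_5)(kb_0+k(n-1)(b_4+b_6)+b_7r)\big)S(X,V)\eta(U)\eta(W)\\ &-\big((b_2+b_3)(-ka_0+k(n-1)(a_1+a_2)-a_7r)+(a_1+a_5)(-kb_0+k(n-1)(b_5+b_6)-b_7r)\big)S(X,U)\eta(V)\eta(W)\\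 &-\big((b_1+b_2)(-ka_0+k(n-1)(a_1+a_2)-a_7r)+k(n-1)(b_4+b_5)(a_1+a_5)\big)S(X,W)\eta(U)\eta(V)\\ &-k(n-1)\big(k(n-1)(b_4+b_5)(a_2+a_4)+(b_1+b_2)(ka_0+k(n-1)a_4+a_7r)\big)g(X,W)\eta(U)\eta(V)\\ =\;&L_g\Big(\varepsilon b_0R(U,V,W,X)+\varepsilon b_4S(X,U)g(V,W)+\varepsilon b_5S(X,V)g(U,W)+\varepsilon b_6S(X,W)g(U,V)\\ &-\varepsilon k(n-1)b_6\,g(U,V)g(X,W)-k(n-1)(b_2+b_3)g(X,U)\eta(V)\eta(W)\\ &-k(n-1)(b_1+b_3)g(X,V)\eta(U)\eta(W)-k(n-1)(b_1+b_2)g(X,W)\eta(U)\eta(V)\\ &+(b_2+b_3)S(X,U)\eta(V)\eta(W)+(b_1+b_3)S(X,V)\eta(U)\eta(W)+(b_1+b_2)S(X,W)\eta(U)\eta(V)\\ &-\varepsilon(-kb_0+k(n-1)b_5)g(U,W)g(X,V)-\varepsilon(kb_0+k(n-1)b_4)g(V,W)g(X,U)\Big). \end{align*}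
   Context: $(M,g)$ is an $n$-dimensional semi-Riemannian manifold; $R$ is its curvature tensor (sign convention: constant curvature $c$ means $R(X,Y)Z=c(g(Y,Z)X-g(X,Z)Y)$), $R(X,Y,Z,V)=g(R(X,Y)Z,V)$, $S(Y,Z)=\mathrm{tr}(X\mapsto R(X,Y)Z)$ the Ricci tensor, $Q$ the Ricci operator ($g(QX,Y)=S(X,Y)$), $r$ the scalar curvature, $S^2(X,Y)=S(QX,Y)$. $(N(k),\xi)$-semi-Riemannian manifold: $k$ is a real number and $\xi$ is a vector field with $g(\xi,\xi)=\varepsilon\in\{1,-1\}$ lying in the $k$-nullity distribution, i.e. $R(X,Y)\xi=k(g(Y,\xi)X-g(X,\xi)Y)$ for all $X,Y$; $\eta(X)=\varepsilon g(X,\xi)$. For real $a_0,\dots,a_7$, the $\mathcal{T}_a$-curvature tensor is $\mathcal{T}_a(X,Y)Z=a_0R(X,Y)Z+a_1S(Y,Z)X+a_2S(X,Z)Y+a_3S(X,Y)Z+a_4g(Y,Z)QX+a_5g(X,Z)QY+a_6g(X,Y)QZ+a_7r(g(Y,Z)X-g(X,Z)Y)$; $\mathcal{T}_b$ is the same with $b_i$ in place of $a_i$. A $(1,1)$ tensor field acts as a derivation on tensors, commuting with contractions. For the $(1,3)$ tensor $\mathcal{T}_b$ and an endomorphism $F$: $(F\cdot\mathcal{T}_b)(U,V)W=F(\mathcal{T}_b(U,V)W)-\mathcal{T}_b(FU,V)W-\mathcal{T}_b(U,FV)W-\mathcal{T}_b(U,V)FW$. Then $\mathcal{T}_a\cdot\mathcal{T}_b$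 is the tensor $(U,V,W;Z,X)\mapsto(\mathcal{T}_a(Z,X)\cdot\mathcal{T}_b)(U,V)W$, and, for a $(0,2)$ tensor $\sigma$, $Q(\sigma,\mathcal{T}_b)(U,V,W;Z,X)=((Z\wedge_\sigma X)\cdot\mathcal{T}_b)(U,V)W$ with $(Z\wedge_\sigma X)Y=\sigma(X,Y)Z-\sigma(Z,Y)X$. *)

theory Defs
  imports "HOL-Analysis.Analysis"
begin

section \<open>Smooth maps on open subsets of Euclidean space\<close>

definition partial_deriv :: "'n \<Rightarrow> (real^'n \<Rightarrow> 'b::real_normed_vector) \<Rightarrow> real^'n \<Rightarrow> 'b"
  where "partial_deriv i f x = frechet_derivative f (at x) (axis i 1)"

text \<open>The derivatives are two-sided (\<open>at x\<close>), so the predicates are meant for open \<open>S\<close>.\<close>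

primrec Ck_on :: "nat \<Rightarrow> (real^'n) set \<Rightarrow> (real^'n \<Rightarrow> 'b::real_normed_vector) \<Rightarrow> bool"
  where
    "Ck_on 0 S f \<longleftrightarrow> continuous_on S f"
  | "Ck_on (Suc m) S f \<longleftrightarrow>
       (\<forall>x\<in>S. f differentiable (at x)) \<and> (\<forall>i. Ck_on m S (partial_deriv i f))"

definition smooth_on :: "(real^'n) set \<Rightarrow> (real^'n \<Rightarrow> 'b::real_normed_vector) \<Rightarrow> bool"
  where "smooth_on S f \<longleftrightarrow> (\<forall>m. Ck_on m S f)"


section \<open>Smooth manifolds, functions and vector fields\<close>

text \<open>A chart is a pair of its domain and its coordinate map. The dimension of the manifold is
  \<open>CARD('n)\<close>. The atlas is not required to be maximal.\<close>

type_synonym ('m, 'n) chart = "'m set \<times> ('m \<Rightarrow> real^'n)"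

definition coord_range :: "('m, 'n::finite) chart \<Rightarrow> (real^'n) set"
  where "coord_range c = snd c ` fst c"

definition coord_rep :: "('m, 'n::finite) chart \<Rightarrow> ('m \<Rightarrow> 'b) \<Rightarrow> real^'n \<Rightarrow> 'b"
  where "coord_rep c f = f \<circ> inv_into (fst c) (snd c)"

definition transition :: "('m, 'n::finite) chart \<Rightarrow> ('m, 'n::finite) chart \<Rightarrow> real^'n \<Rightarrow> real^'n"
  where "transition c d = coord_rep c (snd d)"

definition is_chart :: "'m topology \<Rightarrow> ('m, 'n::finite) chart \<Rightarrow> bool"
  where "is_chart M c \<longleftrightarrow>
    openin M (fst c) \<and> open (coord_range c) \<and>
    homeomorphic_map (subtopology M (fst c)) (top_of_set (coord_range c)) (snd c)"

definition smooth_manifold :: "'m topology \<Rightarrow> ('m, 'n::finite) chart set \<Rightarrow> bool"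
  where "smooth_manifold M A \<longleftrightarrow>
    Hausdorff_space M \<and> second_countable M \<and>
    (\<forall>c\<in>A. is_chart M c) \<and> (\<Union>c\<in>A. fst c) = topspace M \<and>
    (\<forall>c\<in>A. \<forall>d\<in>A. smooth_on (snd c ` (fst c \<inter> fst d)) (transition c d))"

definition smooth_function :: "('m, 'n::finite) chart set \<Rightarrow> ('m \<Rightarrow> real) \<Rightarrow> bool"
  where "smooth_function A f \<longleftrightarrow> (\<forall>c\<in>A. smooth_on (coord_range c) (coord_rep c f))"

text \<open>A vector field assigns to every chart \<open>c\<close> and point \<open>p\<close> its components \<open>X c p\<close> in that chart,
  subject to the transformation law under change of charts. Accordingly, a tangent vector at \<open>p\<close> is
  written below through its components, an element of \<open>real^'n\<close>, in a given chart around \<open>p\<close>, and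
  every tensor at \<open>p\<close> is a multilinear map on these components.\<close>

type_synonym ('m, 'n) vfield = "('m, 'n) chart \<Rightarrow> 'm \<Rightarrow> real^'n"

definition smooth_vector_field :: "('m, 'n::finite) chart set \<Rightarrow> ('m, 'n::finite) vfield \<Rightarrow> bool"
  where "smooth_vector_field A X \<longleftrightarrow>
    (\<forall>c\<in>A. smooth_on (coord_range c) (coord_rep c (X c))) \<and>
    (\<forall>c\<in>A. \<forall>d\<in>A. \<forall>p\<in>fst c \<inter> fst d.
       X d p = jacobian (transition c d) (at (snd c p)) *v X c p)"


section \<open>Semi-Riemannian metrics\<close>

text \<open>A metric is given by its Gram matrix \<open>g c p\<close> in every chart.\<close>

type_synonym ('m, 'n) metric_field = "('m, 'n) chart \<Rightarrow> 'm \<Rightarrow> real^'n^'n"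

definition inner_g :: "('m, 'n::finite) metric_field \<Rightarrow> ('m, 'n::finite) chart \<Rightarrow> 'm \<Rightarrow> real^'n \<Rightarrow> real^'n \<Rightarrow> real"
  where "inner_g g c p u v = u \<bullet> (g c p *v v)"

definition neg_index :: "real^'n^'n \<Rightarrow> nat"
  where "neg_index G = Max {dim W | W. subspace W \<and> (\<forall>w\<in>W. w \<noteq> 0 \<longrightarrow> w \<bullet> (G *v w) < 0)}"

definition semi_riemannian_metric :: "('m, 'n::finite) chart set \<Rightarrow> ('m, 'n::finite) metric_field \<Rightarrow> bool"
  where "semi_riemannian_metric A g \<longleftrightarrow>
    (\<forall>c\<in>A. smooth_on (coord_range c) (coord_rep c (g c))) \<and>
    (\<forall>c\<in>A. \<forall>d\<in>A. \<forall>p\<in>fst c \<inter> fst d.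
       (let J = jacobian (transition c d) (at (snd c p)) in g c p = transpose J ** g d p ** J)) \<and>
    (\<forall>c\<in>A. \<forall>p\<in>fst c. transpose (g c p) = g c p) \<and>
    (\<forall>c\<in>A. \<forall>p\<in>fst c. \<forall>u. (\<forall>v. inner_g g c p u v = 0) \<longrightarrow> u = 0) \<and>
    (\<exists>\<nu>. \<forall>c\<in>A. \<forall>p\<in>fst c. neg_index (g c p) = \<nu>)"

definition semi_riemannian_manifold ::
    "'m topology \<Rightarrow> ('m, 'n::finite) chart set \<Rightarrow> ('m, 'n::finite) metric_field \<Rightarrow> bool"
  where "semi_riemannian_manifold M A g \<longleftrightarrow> smooth_manifold M A \<and> semi_riemannian_metric A g"


section \<open>Levi-Civita connection and curvature\<close>

text \<open>The next four definitions work in coordinates: \<open>G\<close> is the Gram matrix of the metric, and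
  \<open>X\<close>, \<open>Y\<close>, \<open>Z\<close> are vector fields, on an open subset of \<open>real^'n\<close>.\<close>

definition christoffel :: "(real^'n \<Rightarrow> real^'n^'n) \<Rightarrow> real^'n \<Rightarrow> 'n \<Rightarrow> 'n \<Rightarrow> 'n \<Rightarrow> real"
  where "christoffel G x m i j = (1/2) * (\<Sum>l\<in>UNIV. matrix_inv (G x) $ m $ l *
    (partial_deriv i (\<lambda>y. G y $ j $ l) x + partial_deriv j (\<lambda>y. G y $ i $ l) x
      - partial_deriv l (\<lambda>y. G y $ i $ j) x))"

definition cov_deriv ::
    "(real^'n \<Rightarrow> real^'n^'n) \<Rightarrow> (real^'n \<Rightarrow> real^'n) \<Rightarrow> (real^'n \<Rightarrow> real^'n) \<Rightarrow> real^'n \<Rightarrow> real^'n"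
  where "cov_deriv G X Y x = frechet_derivative Y (at x) (X x) +
    (\<chi> m. \<Sum>i\<in>UNIV. \<Sum>j\<in>UNIV. christoffel G x m i j * X x $ i * Y x $ j)"

definition lie_bracket :: "(real^'n \<Rightarrow> real^'n) \<Rightarrow> (real^'n \<Rightarrow> real^'n) \<Rightarrow> real^'n \<Rightarrow> real^'n"
  where "lie_bracket X Y x = frechet_derivative Y (at x) (X x) - frechet_derivative X (at x) (Y x)"

definition curvature_op :: "(real^'n \<Rightarrow> real^'n^'n) \<Rightarrow>
    (real^'n \<Rightarrow> real^'n) \<Rightarrow> (real^'n \<Rightarrow> real^'n) \<Rightarrow> (real^'n \<Rightarrow> real^'n) \<Rightarrow> real^'n \<Rightarrow> real^'n"
  where "curvature_op G X Y Z x =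
    cov_deriv G X (cov_deriv G Y Z) x - cov_deriv G Y (cov_deriv G X Z) x
    - cov_deriv G (lie_bracket X Y) Z x"

text \<open>The curvature tensor \<open>R(u,v)w\<close> at \<open>p\<close>. As \<open>curvature_op\<close> is tensorial, the vectors at \<open>p\<close> may be
  extended to fields arbitrarily; here they are extended with constant components in the chart.\<close>

definition Riem :: "('m, 'n::finite) metric_field \<Rightarrow> ('m, 'n::finite) chart \<Rightarrow> 'm \<Rightarrow>
    real^'n \<Rightarrow> real^'n \<Rightarrow> real^'n \<Rightarrow> real^'n"
  where "Riem g c p u v w =
    curvature_op (coord_rep c (g c)) (\<lambda>_. u) (\<lambda>_. v) (\<lambda>_. w) (snd c p)"

definition Ricci :: "('m, 'n::finite) metric_field \<Rightarrow> ('m, 'n::finite) chart \<Rightarrow> 'm \<Rightarrow> real^'n \<Rightarrow> real^'n \<Rightarrow> real"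
  where "Ricci g c p v w = trace (matrix (\<lambda>u. Riem g c p u v w))"

definition Ricci_op :: "('m, 'n::finite) metric_field \<Rightarrow> ('m, 'n::finite) chart \<Rightarrow> 'm \<Rightarrow> real^'n \<Rightarrow> real^'n"
  where "Ricci_op g c p u = (THE q. \<forall>v. inner_g g c p q v = Ricci g c p u v)"

definition scalar_curv :: "('m, 'n::finite) metric_field \<Rightarrow> ('m, 'n::finite) chart \<Rightarrow> 'm \<Rightarrow> real"
  where "scalar_curv g c p = trace (matrix (Ricci_op g c p))"

definition Ricci_sq :: "('m, 'n::finite) metric_field \<Rightarrow> ('m, 'n::finite) chart \<Rightarrow> 'm \<Rightarrow> real^'n \<Rightarrow> real^'n \<Rightarrow> real"
  where "Ricci_sq g c p u v = Ricci g c p (Ricci_op g c p u) v"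


section \<open>The nullity condition\<close>

definition nullity :: "('m, 'n::finite) metric_field \<Rightarrow> real \<Rightarrow> ('m, 'n::finite) chart \<Rightarrow> 'm \<Rightarrow> (real^'n) set"
  where "nullity g k c p = {z. \<forall>x y. Riem g c p x y z =
    k *\<^sub>R (inner_g g c p y z *\<^sub>R x - inner_g g c p x z *\<^sub>R y)}"

definition Nk_semi_riemannian_manifold :: "'m topology \<Rightarrow> ('m, 'n::finite) chart set \<Rightarrow>
    ('m, 'n::finite) metric_field \<Rightarrow> real \<Rightarrow> ('m, 'n::finite) vfield \<Rightarrow> real \<Rightarrow> bool"
  where "Nk_semi_riemannian_manifold M A g k \<xi> \<epsilon> \<longleftrightarrow>
    semi_riemannian_manifold M A g \<and> smooth_vector_field A \<xi> \<and> \<epsilon> \<in> {1, -1} \<and>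
    (\<forall>c\<in>A. \<forall>p\<in>fst c. inner_g g c p (\<xi> c p) (\<xi> c p) = \<epsilon> \<and> \<xi> c p \<in> nullity g k c p)"

definition eta_form :: "('m, 'n::finite) metric_field \<Rightarrow> ('m, 'n::finite) vfield \<Rightarrow> real \<Rightarrow>
    ('m, 'n::finite) chart \<Rightarrow> 'm \<Rightarrow> real^'n \<Rightarrow> real"
  where "eta_form g \<xi> \<epsilon> c p u = \<epsilon> * inner_g g c p u (\<xi> c p)"


section \<open>The T-curvature tensor and pseudosymmetry\<close>

text \<open>Only the values \<open>a 0, \<dots>, a 7\<close> of the coefficient sequence matter.\<close>

definition T_curv :: "(nat \<Rightarrow> real) \<Rightarrow> ('m, 'n::finite) metric_field \<Rightarrow> ('m, 'n::finite) chart \<Rightarrow> 'm \<Rightarrow>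
    real^'n \<Rightarrow> real^'n \<Rightarrow> real^'n \<Rightarrow> real^'n"
  where "T_curv a g c p x y z =
    a 0 *\<^sub>R Riem g c p x y z
    + (a 1 * Ricci g c p y z) *\<^sub>R x + (a 2 * Ricci g c p x z) *\<^sub>R y + (a 3 * Ricci g c p x y) *\<^sub>R z
    + (a 4 * inner_g g c p y z) *\<^sub>R Ricci_op g c p x
    + (a 5 * inner_g g c p x z) *\<^sub>R Ricci_op g c p y
    + (a 6 * inner_g g c p x y) *\<^sub>R Ricci_op g c p z
    + (a 7 * scalar_curv g c p) *\<^sub>R (inner_g g c p y z *\<^sub>R x - inner_g g c p x z *\<^sub>R y)"

definition derivation_act :: "('v \<Rightarrow> 'v) \<Rightarrow> ('v \<Rightarrow> 'v \<Rightarrow> 'v \<Rightarrow> 'v) \<Rightarrow> 'v \<Rightarrow> 'v \<Rightarrow> 'v \<Rightarrow> 'v::ab_group_add"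
  where "derivation_act F T u v w = F (T u v w) - T (F u) v w - T u (F v) w - T u v (F w)"

definition wedge_op :: "('v \<Rightarrow> 'v \<Rightarrow> real) \<Rightarrow> 'v \<Rightarrow> 'v \<Rightarrow> 'v \<Rightarrow> 'v::real_vector"
  where "wedge_op \<sigma> z x y = \<sigma> x y *\<^sub>R z - \<sigma> z y *\<^sub>R x"

definition Q_tensor :: "('v \<Rightarrow> 'v \<Rightarrow> real) \<Rightarrow> ('v \<Rightarrow> 'v \<Rightarrow> 'v \<Rightarrow> 'v) \<Rightarrow>
    'v \<Rightarrow> 'v \<Rightarrow> 'v \<Rightarrow> 'v \<Rightarrow> 'v \<Rightarrow> 'v::real_vector"
  where "Q_tensor \<sigma> T u v w z x = derivation_act (wedge_op \<sigma> z x) T u v w"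

definition Ta_Tb_pseudosymmetric :: "('m, 'n::finite) chart set \<Rightarrow> ('m, 'n::finite) metric_field \<Rightarrow>
    (nat \<Rightarrow> real) \<Rightarrow> (nat \<Rightarrow> real) \<Rightarrow> ('m \<Rightarrow> real) \<Rightarrow> bool"
  where "Ta_Tb_pseudosymmetric A g a b L \<longleftrightarrow>
    smooth_function A L \<and>
    (\<forall>c\<in>A. \<forall>p\<in>fst c. \<forall>u v w z x.
       derivation_act (T_curv a g c p z x) (T_curv b g c p) u v w
       = L p *\<^sub>R Q_tensor (inner_g g c p) (T_curv b g c p) u v w z x)"

end

theory Submission
  imports Defs
begin

text \<open>
  The identity is the pseudosymmetry condition \<open>(T\<^sub>a(Z,X) \<cdot> T\<^sub>b)(U,V)W = L Q(g,T\<^sub>b)(U,V,W;Z,X)\<close> at one point, for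
  \<open>Z = \<xi>\<close>, paired with \<open>\<xi>\<close>.

  The reason that it closes up is that \<open>\<xi>\<close> removes the Riemann tensor. By the nullity condition and the
  symmetries of \<open>R\<close>, both \<open>R(\<xi>,X)Y\<close> and \<open>g(R(U,V)W,\<xi>)\<close> are expressed by the metric, and
  \<open>\<xi>\<close> is an eigenvector of the Ricci operator with eigenvalue \<open>k(n-1)\<close>. Hence \<open>T\<^sub>a(\<xi>,X)\<close> is a
  combination of six elementary endomorphisms (lemma \<open>T_xi_left\<close>), and
  \<open>\<Phi>(U,V,W) = g(T\<^sub>b(U,V)W,\<xi>)\<close> is a trilinear form in \<open>g\<close>, \<open>S\<close> and \<open>\<eta>\<close> (lemma \<open>G_T_xi\<close>). A
  derivation along such an endomorphism is computed by the multilinearity of \<open>\<Phi>\<close> (lemma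
  \<open>derivation_T_xi\<close>); since \<open>\<xi> \<and>\<^sub>g X\<close> is a combination of the same kind, this covers both sides of the condition.
  The curvature tensor survives only in \<open>g(R(U,V)W,X)\<close> and \<open>S(X,R(U,V)W)\<close>, which come from
  the endomorphisms \<open>g(X,\<cdot>)\<xi>\<close> and \<open>S(X,\<cdot>)\<xi>\<close>.

  The argument needs the pair symmetry of \<open>R\<close> and the symmetry of \<open>S\<close>. As the curvature is defined by
  Christoffel symbols in a chart, they rest on the classical computation: the first Bianchi identity holds because
  the connection has no torsion, and \<open>g(R(u,v)w,z)\<close> is skew in \<open>w\<close> and \<open>z\<close> because the second
  derivatives of the Gram matrix commute (lemmas \<open>second_derivative_symmetric\<close>, \<open>first_bianchi\<close>,
  \<open>curv_metric_skew\<close>). The metric may be indefinite, so the Ricci tensor is shown to be symmetric by an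
  adjointness argument for traces (lemma \<open>trace_matrix_adjoint\<close>) in place of an orthonormal frame.
\<close>

section \<open>Second derivatives\<close>

lemma frechet_derivative_cong_open:
  assumes "open S" "x \<in> S" "\<And>y. y \<in> S \<Longrightarrow> f y = h y"
  shows "frechet_derivative f (at x) = frechet_derivative h (at x)"
proof -
  have "(f has_derivative D) (at x) \<longleftrightarrow> (h has_derivative D) (at x)" for D
    using assms has_derivative_transform_within_open by metis
  then show ?thesis by (simp add: frechet_derivative_def)
qed

lemma differentiable_cong_open:
  assumes "open S" "x \<in> S" "\<And>y. y \<in> S \<Longrightarrow> f y = h y"
  shows "f differentiable (at x) \<longleftrightarrow> h differentiable (at x)"
  unfolding differentiable_def
  using assms has_derivative_transform_within_open by metis

lemma has_real_derivative_along_line: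
  fixes f :: "'a::real_normed_vector \<Rightarrow> real"
  assumes "f differentiable (at (y + t *\<^sub>R v))"
  shows "((\<lambda>t. f (y + t *\<^sub>R v)) has_real_derivative frechet_derivative f (at (y + t *\<^sub>R v)) v) (at t)"
proof -
  let ?D = "frechet_derivative f (at (y + t *\<^sub>R v))"
  have 1: "(f has_derivative ?D) (at (y + t *\<^sub>R v))"
    using assms frechet_derivative_works by blast
  have 2: "((\<lambda>t. y + t *\<^sub>R v) has_derivative (\<lambda>r. r *\<^sub>R v)) (at t)"
    by (auto intro!: derivative_eq_intros)
  have "((\<lambda>t. f (y + t *\<^sub>R v)) has_derivative (\<lambda>r. ?D (r *\<^sub>R v))) (at t)"
    using has_derivative_compose[of "\<lambda>t. y + t *\<^sub>R v" "\<lambda>r. r *\<^sub>R v" t UNIV f ?D] 1 2 by simp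
  then show ?thesis
    unfolding has_field_derivative_def using linear_scale[OF has_derivative_linear[OF 1]]
    by (simp add: mult_commute_abs)
qed

text \<open>The mean value theorem, once in the direction \<open>u\<close> and once in the direction \<open>v\<close>. The left-hand side
  of the equation is symmetric in \<open>u\<close> and \<open>v\<close>, so exchanging the two directions equates values of the
  two mixed derivatives at nearby points.\<close>

lemma mixed_difference_mean_value:
  fixes f :: "'a::real_normed_vector \<Rightarrow> real"
  assumes f: "\<And>y. y \<in> S \<Longrightarrow> f differentiable (at y)"
    and fu: "\<And>y. y \<in> S \<Longrightarrow> (\<lambda>z. frechet_derivative f (at z) u) differentiable (at y)"
    and h: "0 < h" and S: "\<And>s t. 0 \<le> s \<Longrightarrow> s \<le> h \<Longrightarrow> 0 \<le> t \<Longrightarrow> t \<le> h \<Longrightarrow> x + s *\<^sub>R u + t *\<^sub>R v \<in> S"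
  obtains s t where "0 < s" "s < h" "0 < t" "t < h"
    "f (x + h *\<^sub>R u + h *\<^sub>R v) - f (x + h *\<^sub>R u) - f (x + h *\<^sub>R v) + f x
      = h * h * frechet_derivative (\<lambda>z. frechet_derivative f (at z) u) (at (x + s *\<^sub>R u + t *\<^sub>R v)) v"
proof -
  define F where "F z = frechet_derivative f (at z) u" for z
  define A where "A s = f (x + h *\<^sub>R v + s *\<^sub>R u) - f (x + s *\<^sub>R u)" for s
  have dA: "(A has_real_derivative F (x + h *\<^sub>R v + s *\<^sub>R u) - F (x + s *\<^sub>R u)) (at s)"
    if "0 \<le> s" "s \<le> h" for s
  proof -
    have "x + h *\<^sub>R v + s *\<^sub>R u \<in> S" "x + s *\<^sub>R u \<in> S"
      using S[of s h] S[of s 0] that h by (simp_all add: add_ac)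
    then show ?thesis
      unfolding A_def F_def by (intro DERIV_diff has_real_derivative_along_line f)
  qed
  obtain s where s: "0 < s" "s < h" "A h - A 0 = h * (F (x + h *\<^sub>R v + s *\<^sub>R u) - F (x + s *\<^sub>R u))"
    using MVT2[OF h, of A "\<lambda>s. F (x + h *\<^sub>R v + s *\<^sub>R u) - F (x + s *\<^sub>R u)"] dA by auto
  let ?C = "\<lambda>t. F (x + s *\<^sub>R u + t *\<^sub>R v)"
    and ?D = "\<lambda>t. frechet_derivative F (at (x + s *\<^sub>R u + t *\<^sub>R v)) v"
  have "(?C has_real_derivative ?D t) (at t)" if "0 \<le> t" "t \<le> h" for t
    using fu[OF S, of s t] that s by (intro has_real_derivative_along_line) (simp add: F_def)
  then obtain t where t: "0 < t" "t < h" "?C h - ?C 0 = h * ?D t"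
    using MVT2[OF h, of ?C ?D] by auto
  have F: "F = (\<lambda>z. frechet_derivative f (at z) u)" by (simp add: F_def fun_eq_iff)
  have "A h = f (x + h *\<^sub>R u + h *\<^sub>R v) - f (x + h *\<^sub>R u)" "A 0 = f (x + h *\<^sub>R v) - f x"
    "F (x + h *\<^sub>R v + s *\<^sub>R u) = F (x + s *\<^sub>R u + h *\<^sub>R v)"
    by (simp_all add: A_def add_ac)
  then have "f (x + h *\<^sub>R u + h *\<^sub>R v) - f (x + h *\<^sub>R u) - f (x + h *\<^sub>R v) + f x = h * (h * ?D t)"
    using s(3) t(3) by simp
  then show ?thesis
    using that[OF s(1,2) t(1,2)] unfolding F by (simp only: mult.assoc)
qed

text \<open>Schwarz's theorem. Expanding the second difference over shrinking parallelograms in the two possible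
  orders gives values of the two mixed derivatives at points tending to \<open>x\<close>; they agree, so the
  continuity of both mixed derivatives at \<open>x\<close> gives the claim.\<close>

theorem second_derivative_symmetric:
  fixes f :: "'a::real_normed_vector \<Rightarrow> real"
  assumes S: "open S" "x \<in> S" and f: "\<And>y. y \<in> S \<Longrightarrow> f differentiable (at y)"
    and f1: "\<And>y u. y \<in> S \<Longrightarrow> (\<lambda>z. frechet_derivative f (at z) u) differentiable (at y)"
    and f2: "\<And>u v. isCont (\<lambda>y. frechet_derivative (\<lambda>z. frechet_derivative f (at z) u) (at y) v) x"
  shows "frechet_derivative (\<lambda>z. frechet_derivative f (at z) u) (at x) v
       = frechet_derivative (\<lambda>z. frechet_derivative f (at z) v) (at x) u"
proof -
  define D where "D u v y = frechet_derivative (\<lambda>z. frechet_derivative f (at z) u) (at y) v" for u v y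
  obtain e where e: "e > 0" "ball x e \<subseteq> S" using S openE by blast
  \<comment> \<open>The parallelogram spanned at \<open>x\<close> by \<open>h u\<close> and \<open>h v\<close> stays in the ball for \<open>h \<le> c\<close>.\<close>
  define c where "c = e / (2 * (norm u + norm v + 1))"
  have c: "c > 0" using e by (simp add: c_def add_nonneg_pos)
  have small: "norm (s *\<^sub>R u + t *\<^sub>R v) \<le> h * (norm u + norm v)"
    if "0 \<le> s" "s \<le> h" "0 \<le> t" "t \<le> h" for s t h
  proof -
    have "norm (s *\<^sub>R u + t *\<^sub>R v) \<le> norm (s *\<^sub>R u) + norm (t *\<^sub>R v)" by (rule norm_triangle_ineq)
    also have "\<dots> \<le> h * norm u + h * norm v" using that by (intro add_mono) (auto intro: mult_right_mono)
    finally show ?thesis by (simp add: algebra_simps)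
  qed
  have inS: "x + s *\<^sub>R u + t *\<^sub>R v \<in> S" if "0 \<le> s" "s \<le> h" "0 \<le> t" "t \<le> h" "h \<le> c" for s t h
  proof -
    have "h * (norm u + norm v) \<le> c * (norm u + norm v)" using that by (intro mult_right_mono) auto
    also have "\<dots> \<le> e * (1/2)"
      using e unfolding c_def by (simp add: divide_simps) (smt (verit) norm_ge_zero mult_nonneg_nonneg)
    also have "\<dots> < e" using e by simp
    finally have "norm (s *\<^sub>R u + t *\<^sub>R v) < e" using small[OF that(1-4)] by linarith
    moreover have "dist x (x + a) = norm a" for a :: 'a by (simp add: dist_norm)
    ultimately have "x + s *\<^sub>R u + t *\<^sub>R v \<in> ball x e" by (simp add: add.assoc)
    then show ?thesis using e by blast
  qed
  have inS': "x + t *\<^sub>R v + s *\<^sub>R u \<in> S" if "0 \<le> t" "t \<le> h" "0 \<le> s" "s \<le> h" "h \<le> c" for s t h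
    using inS[of s h t] that by (simp add: add_ac)
  define h where "h i = c / Suc i" for i
  have h: "0 < h i" "h i \<le> c" for i
    using c by (auto simp: h_def divide_simps mult_left_mono)
  have h0: "h \<longlonglongrightarrow> 0" unfolding h_def
    using tendsto_mult_right_zero[OF LIMSEQ_inverse_real_of_nat, of c] by (simp add: divide_inverse)
  have "\<exists>s t s' t'. {s, t, s', t'} \<subseteq> {0..h i} \<and>
      D u v (x + s *\<^sub>R u + t *\<^sub>R v) = D v u (x + s' *\<^sub>R u + t' *\<^sub>R v)" for i
  proof -
    obtain s t where 1: "0 < s" "s < h i" "0 < t" "t < h i"
      "f (x + h i *\<^sub>R u + h i *\<^sub>R v) - f (x + h i *\<^sub>R u) - f (x + h i *\<^sub>R v) + f x
        = h i * h i * D u v (x + s *\<^sub>R u + t *\<^sub>R v)"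
      unfolding D_def by (rule mixed_difference_mean_value[of S f u "h i" x v]) (use f f1 h inS in auto)
    obtain t' s' where 2: "0 < t'" "t' < h i" "0 < s'" "s' < h i"
      "f (x + h i *\<^sub>R v + h i *\<^sub>R u) - f (x + h i *\<^sub>R v) - f (x + h i *\<^sub>R u) + f x
        = h i * h i * D v u (x + t' *\<^sub>R v + s' *\<^sub>R u)"
      unfolding D_def
      by (rule mixed_difference_mean_value[of S f v "h i" x u]) (use f f1 h inS' in auto)
    have "h i * h i * D u v (x + s *\<^sub>R u + t *\<^sub>R v) = h i * h i * D v u (x + s' *\<^sub>R u + t' *\<^sub>R v)"
      using 1(5) 2(5) by (simp add: algebra_simps)
    then show ?thesis using 1 2 h(1)[of i] by (intro exI[of _ s] exI[of _ t] exI[of _ s'] exI[of _ t']) auto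
  qed
  then obtain s t s' t' where st: "\<And>i. {s i, t i, s' i, t' i} \<subseteq> {0..h i}"
      "\<And>i. D u v (x + s i *\<^sub>R u + t i *\<^sub>R v) = D v u (x + s' i *\<^sub>R u + t' i *\<^sub>R v)"
    by metis
  have lim0: "q \<longlonglongrightarrow> 0" if "\<And>i. q i \<in> {0..h i}" for q
    by (rule real_tendsto_sandwich[OF _ _ tendsto_const h0]) (use that in auto)
  have "(\<lambda>i. x + p i *\<^sub>R u + q i *\<^sub>R v) \<longlonglongrightarrow> x" if "\<And>i. p i \<in> {0..h i}" "\<And>i. q i \<in> {0..h i}" for p q
    using that by (auto intro!: tendsto_eq_intros lim0)
  then have lim: "(\<lambda>i. D a b (x + p i *\<^sub>R u + q i *\<^sub>R v)) \<longlonglongrightarrow> D a b x"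
    if "\<And>i. p i \<in> {0..h i}" "\<And>i. q i \<in> {0..h i}" for p q a b
    using isCont_tendsto_compose[OF f2[of a b, folded D_def]] that by blast
  have "(\<lambda>i. D u v (x + s i *\<^sub>R u + t i *\<^sub>R v)) \<longlonglongrightarrow> D u v x" by (rule lim) (use st in auto)
  moreover have "(\<lambda>i. D u v (x + s i *\<^sub>R u + t i *\<^sub>R v)) \<longlonglongrightarrow> D v u x"
    unfolding st(2) by (rule lim) (use st in auto)
  ultimately show ?thesis using LIMSEQ_unique unfolding D_def by blast
qed

lemma linear_basis_expansion:
  fixes f :: "real^'n \<Rightarrow> 'b::real_vector"
  assumes "linear f"
  shows "f u = (\<Sum>i\<in>UNIV. u $ i *\<^sub>R f (axis i 1))"
proof -
  have "f u = f (\<Sum>i\<in>UNIV. u $ i *\<^sub>R axis i 1)"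
    by (metis basis_expansion scalar_mult_eq_scaleR)
  then show ?thesis by (simp add: linear_sum[OF assms] linear_scale[OF assms])
qed

lemma frechet_derivative_partials:
  fixes f :: "real^'n \<Rightarrow> 'b::real_normed_vector"
  assumes "f differentiable (at y)"
  shows "frechet_derivative f (at y) u = (\<Sum>i\<in>UNIV. u $ i *\<^sub>R partial_deriv i f y)"
proof -
  have "linear (frechet_derivative f (at y))" using assms linear_frechet_derivative by blast
  then show ?thesis unfolding partial_deriv_def by (rule linear_basis_expansion)
qed

text \<open>The class \<open>Ck_on\<close> speaks of partial derivatives along the axes. The curvature computation
  differentiates along arbitrary vectors and needs the same regularity for those.\<close>

lemma C2_directional:
  fixes f :: "real^'n \<Rightarrow> 'b::real_normed_vector"
  assumes S: "open S" and f: "Ck_on 2 S f" and y: "y \<in> S"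
  shows "f differentiable (at y)"
    and "(\<lambda>z. frechet_derivative f (at z) u) differentiable (at y)"
    and "isCont (\<lambda>y. frechet_derivative (\<lambda>z. frechet_derivative f (at z) u) (at y) v) y"
proof -
  note f' = f[unfolded numeral_2_eq_2 Ck_on.simps]
  have 1: "f differentiable (at z)" if "z \<in> S" for z using f' that by blast
  have 2: "partial_deriv i f differentiable (at z)" if "z \<in> S" for i z using f' that by blast
  have 3: "isCont (partial_deriv j (partial_deriv i f)) z" if "z \<in> S" for i j z
    using f' that S continuous_on_eq_continuous_at by blast
  let ?D = "\<lambda>z. frechet_derivative f (at z) u"
  let ?E = "\<lambda>z. \<Sum>i\<in>UNIV. u $ i *\<^sub>R partial_deriv i f z"
  have eq: "?D z = ?E z" if "z \<in> S" for z using 1[OF that] by (rule frechet_derivative_partials)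
  have E: "(?E has_derivative (\<lambda>v. \<Sum>i\<in>UNIV. u $ i *\<^sub>R frechet_derivative (partial_deriv i f) (at z) v)) (at z)"
    if "z \<in> S" for z
    using frechet_derivative_works[THEN iffD1, OF 2[OF that]] by (auto intro!: derivative_intros)
  show "f differentiable (at y)" using 1 y .
  show "?D differentiable (at y)"
    using differentiable_cong_open[OF S y, of ?D ?E] eq E[OF y] unfolding differentiable_def by blast
  have "frechet_derivative ?D (at z) v = (\<Sum>i\<in>UNIV. u $ i *\<^sub>R (\<Sum>j\<in>UNIV. v $ j *\<^sub>R partial_deriv j (partial_deriv i f) z))"
    if "z \<in> S" for z
  proof -
    have "frechet_derivative ?D (at z) = frechet_derivative ?E (at z)"
      using S that eq by (rule frechet_derivative_cong_open)
    also have "\<dots> = (\<lambda>v. \<Sum>i\<in>UNIV. u $ i *\<^sub>R frechet_derivative (partial_deriv i f) (at z) v)"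
      using frechet_derivative_at[OF E[OF that]] by simp
    finally show ?thesis using frechet_derivative_partials[OF 2[OF that]] by simp
  qed
  then have "(\<forall>\<^sub>F z in nhds y. frechet_derivative ?D (at z) v = (\<Sum>i\<in>UNIV. u $ i *\<^sub>R (\<Sum>j\<in>UNIV. v $ j *\<^sub>R partial_deriv j (partial_deriv i f) z)))"
    using S y eventually_nhds by blast
  then show "isCont (\<lambda>y. frechet_derivative ?D (at y) v) y"
    by (subst isCont_cong) (auto intro!: continuous_intros 3 y)
qed

section \<open>The Levi-Civita connection in coordinates\<close>

lemma differentiable_prod_real:
  fixes f :: "'i \<Rightarrow> 'a::real_normed_vector \<Rightarrow> real"
  assumes "finite I" "\<And>i. i \<in> I \<Longrightarrow> f i differentiable (at x)"
  shows "(\<lambda>z. \<Prod>i\<in>I. f i z) differentiable (at x)"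
  using assms by (induction I rule: finite_induct) auto

lemma differentiable_det:
  fixes M :: "'a::real_normed_vector \<Rightarrow> real^'n^'n"
  assumes "\<And>i j. (\<lambda>z. M z $ i $ j) differentiable (at x)"
  shows "(\<lambda>z. det (M z)) differentiable (at x)"
  unfolding det_def by (intro differentiable_sum differentiable_mult ballI finite_permutations finite_class.finite_UNIV
      differentiable_const differentiable_prod_real assms)

lemma differentiable_vec_lambda:
  fixes f :: "'a::real_normed_vector \<Rightarrow> real^'n"
  assumes "\<And>i. (\<lambda>z. f z $ i) differentiable (at x)"
  shows "f differentiable (at x)"
proof -
  obtain D where D: "\<And>i. ((\<lambda>z. f z $ i) has_derivative D i) (at x)"
    using assms unfolding differentiable_def by metis
  have "(f has_derivative (\<lambda>h. \<chi> i. D i h)) (at x)"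
    using D by (subst has_derivative_componentwise_within) (auto simp: Basis_vec_def inner_axis)
  then show ?thesis unfolding differentiable_def by blast
qed

lemma matrix_inv_mult:
  fixes A :: "real^'n^'n"
  assumes "invertible A"
  shows "A *v (matrix_inv A *v b) = b"
proof -
  have "A ** matrix_inv A = mat 1 \<and> matrix_inv A ** A = mat 1"
    using assms unfolding invertible_def matrix_inv_def by (rule someI_ex)
  then show ?thesis by (simp add: matrix_vector_mul_assoc)
qed

text \<open>By Cramer's rule the solution of a linear system is a rational function of its entries. This gives
  the differentiability of the Christoffel symbols, which involve the inverse of the Gram matrix.\<close>

lemma differentiable_linear_system_solution:
  fixes A :: "'a::real_normed_vector \<Rightarrow> real^'n^'n"
  assumes S: "open S" "x \<in> S" and inv: "\<And>z. z \<in> S \<Longrightarrow> invertible (A z)"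
    and A: "\<And>i j. (\<lambda>z. A z $ i $ j) differentiable (at x)"
    and b: "\<And>i. (\<lambda>z. b z $ i) differentiable (at x)"
  shows "(\<lambda>z. matrix_inv (A z) *v b z) differentiable (at x)"
proof -
  let ?M = "\<lambda>k z. \<chi> i j. if j = k then b z $ i else A z $ i $ j"
  have det: "det (A z) \<noteq> 0" if "z \<in> S" for z
    using inv[OF that] by (simp add: invertible_det_nz)
  have eq: "matrix_inv (A z) *v b z = (\<chi> k. det (?M k z) / det (A z))" if "z \<in> S" for z
    using matrix_inv_mult[OF inv[OF that]] cramer[OF det[OF that]] by blast
  have "(\<lambda>z. ?M k z $ i $ j) differentiable (at x)" for i j k
    using A b by (cases "j = k") auto
  then have M: "(\<lambda>z. det (?M k z)) differentiable (at x)" for k by (rule differentiable_det)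
  have "(\<lambda>z. (\<chi> k. det (?M k z) / det (A z)) $ i) differentiable (at x)" for i
    using differentiable_divide[OF M differentiable_det[OF A] det[OF S(2)], of i] by simp
  then have "(\<lambda>z. \<chi> k. det (?M k z) / det (A z)) differentiable (at x)"
    by (rule differentiable_vec_lambda)
  then show ?thesis
    using differentiable_cong_open[where f = "\<lambda>z. matrix_inv (A z) *v b z", OF S eq] by simp
qed

lemma bounded_linear_matrix_form: "bounded_linear (\<lambda>A::real^'n^'n. v \<bullet> (A *v w))"
  unfolding linear_conv_bounded_linear[symmetric]
  by (intro linearI) (simp_all add: matrix_vector_mult_add_rdistrib inner_add_right
      scaleR_matrix_vector_assoc[symmetric])

lemma inner_matrix_axis: "axis i 1 \<bullet> ((A::real^'n^'n) *v axis j 1) = A $ i $ j"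
  by (simp add: inner_axis' matrix_vector_mul_component inner_axis)

text \<open>The situation in one chart: \<open>G\<close> is the Gram matrix of a nondegenerate metric of class \<open>C\<^sup>2\<close> on an open
  set of coordinates.\<close>

locale local_metric =
  fixes G :: "real^'n \<Rightarrow> real^'n^'n" and S :: "(real^'n) set"
  assumes open_S: "open S" and C2: "Ck_on 2 S G"
    and sym: "\<And>y. y \<in> S \<Longrightarrow> transpose (G y) = G y"
    and inv: "\<And>y. y \<in> S \<Longrightarrow> invertible (G y)"
begin

definition B :: "real^'n \<Rightarrow> real^'n \<Rightarrow> real^'n \<Rightarrow> real"
  where "B v w y = v \<bullet> (G y *v w)"

definition dB :: "real^'n \<Rightarrow> real^'n \<Rightarrow> real^'n \<Rightarrow> real^'n \<Rightarrow> real"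
  where "dB u v w y = frechet_derivative (B v w) (at y) u"

text \<open>The right-hand side of the Koszul formula \<open>g(\<nabla>\<^sub>u v, w) = \<dots>\<close> for constant fields, whose brackets vanish.\<close>

definition koszul :: "real^'n \<Rightarrow> real^'n \<Rightarrow> real^'n \<Rightarrow> real^'n \<Rightarrow> real"
  where "koszul u v w y = (1/2) * (dB u v w y + dB v u w y - dB w u v y)"

text \<open>The covariant derivative of the constant field \<open>v\<close> in the direction \<open>u\<close>, i.e. the Christoffel symbols as a
  vector-valued bilinear map. The curvature identities below become manipulations of this map without
  indices.\<close>

definition \<Gamma> :: "real^'n \<Rightarrow> real^'n \<Rightarrow> real^'n \<Rightarrow> real^'n"
  where "\<Gamma> u v y = (\<chi> m. \<Sum>i\<in>UNIV. \<Sum>j\<in>UNIV. christoffel G y m i j * u $ i * v $ j)"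

lemma B_sym: "y \<in> S \<Longrightarrow> B v w y = B w v y"
  unfolding B_def using dot_lmul_matrix[of v "G y" w] vector_transpose_matrix[of v "G y"] sym[of y]
  by (metis inner_commute transpose_matrix_vector)

lemma G_has_derivative: "y \<in> S \<Longrightarrow> (G has_derivative frechet_derivative G (at y)) (at y)"
  using C2_directional(1)[OF open_S C2] frechet_derivative_works by blast

lemma B_has_derivative:
  "y \<in> S \<Longrightarrow> (B v w has_derivative (\<lambda>u. v \<bullet> (frechet_derivative G (at y) u *v w))) (at y)"
  using bounded_linear.has_derivative[OF bounded_linear_matrix_form G_has_derivative, of y v w]
  by (simp add: B_def[abs_def])

lemma dB_eq: "y \<in> S \<Longrightarrow> dB u v w y = v \<bullet> (frechet_derivative G (at y) u *v w)"
  unfolding dB_def using frechet_derivative_at[OF B_has_derivative] by metis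

lemma linear_dB:
  assumes y: "y \<in> S"
  shows "linear (\<lambda>u. dB u v w y)" "linear (\<lambda>v. dB u v w y)" "linear (\<lambda>w. dB u v w y)"
proof -
  show "linear (\<lambda>u. dB u v w y)"
    using has_derivative_linear[OF B_has_derivative[OF y]] by (simp add: dB_eq[OF y])
  show "linear (\<lambda>v. dB u v w y)"
    by (intro linearI) (simp_all add: dB_eq[OF y] inner_add_left)
  show "linear (\<lambda>w. dB u v w y)"
    by (intro linearI) (simp_all add: dB_eq[OF y] matrix_vector_right_distrib inner_add_right
        matrix_scaleR_vector_ac scaleR_matrix_vector_assoc[symmetric])
qed

lemma dB_sym:
  assumes "y \<in> S"
  shows "dB u v w y = dB u w v y"
  unfolding dB_def using frechet_derivative_cong_open[OF open_S assms, of "B v w" "B w v"] B_sym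
  by metis

lemma linear_koszul:
  assumes y: "y \<in> S"
  shows "linear (\<lambda>u. koszul u v w y)" "linear (\<lambda>v. koszul u v w y)" "linear (\<lambda>w. koszul u v w y)"
  by (rule linearI; simp add: koszul_def linear_add[OF linear_dB(1)[OF y]] linear_add[OF linear_dB(2)[OF y]]
      linear_add[OF linear_dB(3)[OF y]] linear_scale[OF linear_dB(1)[OF y]]
      linear_scale[OF linear_dB(2)[OF y]] linear_scale[OF linear_dB(3)[OF y]] algebra_simps)+

lemma christoffel_koszul:
  assumes y: "y \<in> S"
  shows "christoffel G y m i j
    = (\<Sum>l\<in>UNIV. matrix_inv (G y) $ m $ l * koszul (axis i 1) (axis j 1) (axis l 1) y)"
proof -
  have "partial_deriv i (\<lambda>z. G z $ j $ l) y = dB (axis i 1) (axis j 1) (axis l 1) y" for i j l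
    unfolding partial_deriv_def dB_def B_def[abs_def] inner_matrix_axis ..
  then show ?thesis
    unfolding christoffel_def koszul_def by (simp add: sum_distrib_left algebra_simps)
qed

lemma Gamma_eq:
  assumes y: "y \<in> S"
  shows "\<Gamma> u v y = matrix_inv (G y) *v (\<chi> l. koszul u v (axis l 1) y)"
proof -
  \<comment> \<open>Trilinearity reduces the Koszul expression to Christoffel symbols of the first kind.\<close>
  have K: "koszul u v w y = (\<Sum>i\<in>UNIV. \<Sum>j\<in>UNIV. koszul (axis i 1) (axis j 1) w y * u $ i * v $ j)" for w
  proof -
    have 1: "koszul u v w y = (\<Sum>i\<in>UNIV. u $ i * koszul (axis i 1) v w y)"
      by (rule linear_basis_expansion[OF linear_koszul(1)[OF y], unfolded real_scaleR_def])
    have 2: "koszul (axis i 1) v w y = (\<Sum>j\<in>UNIV. v $ j * koszul (axis i 1) (axis j 1) w y)" for i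
      by (rule linear_basis_expansion[OF linear_koszul(2)[OF y], unfolded real_scaleR_def])
    show ?thesis by (subst 1) (simp add: 2 sum_distrib_left mult_ac)
  qed
  have "\<Gamma> u v y $ m = (matrix_inv (G y) *v (\<chi> l. koszul u v (axis l 1) y)) $ m" for m
  proof -
    have "\<Gamma> u v y $ m = (\<Sum>i\<in>UNIV. \<Sum>j\<in>UNIV. \<Sum>l\<in>UNIV.
        matrix_inv (G y) $ m $ l * (koszul (axis i 1) (axis j 1) (axis l 1) y * u $ i * v $ j))"
      by (simp add: \<Gamma>_def christoffel_koszul[OF y] sum_distrib_left sum_distrib_right mult_ac)
    also have "\<dots> = (\<Sum>i\<in>UNIV. \<Sum>l\<in>UNIV. \<Sum>j\<in>UNIV.
        matrix_inv (G y) $ m $ l * (koszul (axis i 1) (axis j 1) (axis l 1) y * u $ i * v $ j))"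
      by (intro sum.cong refl sum.swap)
    also have "\<dots> = (\<Sum>l\<in>UNIV. \<Sum>i\<in>UNIV. \<Sum>j\<in>UNIV.
        matrix_inv (G y) $ m $ l * (koszul (axis i 1) (axis j 1) (axis l 1) y * u $ i * v $ j))"
      by (rule sum.swap)
    also have "\<dots> = (\<Sum>l\<in>UNIV. matrix_inv (G y) $ m $ l * koszul u v (axis l 1) y)"
      by (subst K) (simp add: sum_distrib_left)
    finally show ?thesis by (simp add: matrix_vector_mult_def)
  qed
  then show ?thesis by (simp add: vec_eq_iff)
qed

lemma B_Gamma:
  assumes y: "y \<in> S"
  shows "B w (\<Gamma> u v y) y = koszul u v w y"
proof -
  have "B w (\<Gamma> u v y) y = (\<Sum>l\<in>UNIV. w $ l * koszul u v (axis l 1) y)"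
    by (simp add: B_def Gamma_eq[OF y] matrix_inv_mult[OF inv[OF y]] inner_vec_def)
  also have "\<dots> = koszul u v w y"
    using linear_basis_expansion[OF linear_koszul(3)[OF y], of u v w] by simp
  finally show ?thesis .
qed

text \<open>The Levi-Civita connection preserves the metric: adding the Koszul formulas for \<open>(u,v,w)\<close> and
  \<open>(u,w,v)\<close> leaves only the derivative of \<open>g(v,w)\<close>.\<close>

lemma metric_compatible:
  assumes y: "y \<in> S"
  shows "dB u v w y = B (\<Gamma> u v y) w y + B v (\<Gamma> u w y) y"
  unfolding B_sym[OF y, of "\<Gamma> u v y" w] B_Gamma[OF y] koszul_def
  using dB_sym[OF y, of v u w] dB_sym[OF y, of w u v] dB_sym[OF y, of u w v] by argo

lemma Gamma_sym:
  assumes y: "y \<in> S"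
  shows "\<Gamma> u v y = \<Gamma> v u y"
proof -
  have "koszul u v w y = koszul v u w y" for w
    unfolding koszul_def dB_sym[OF y, of w u v] by simp
  then show ?thesis by (simp add: Gamma_eq[OF y])
qed

lemma Gamma_linear:
  "\<Gamma> (a *\<^sub>R u + u') v y = a *\<^sub>R \<Gamma> u v y + \<Gamma> u' v y"
  "\<Gamma> u (a *\<^sub>R v + v') y = a *\<^sub>R \<Gamma> u v y + \<Gamma> u v' y"
  by (simp_all add: \<Gamma>_def vec_eq_iff sum_distrib_left sum.distrib algebra_simps)

lemma dB_has_derivative:
  assumes y: "y \<in> S"
  shows "(dB u v w has_derivative
    (\<lambda>t. v \<bullet> (frechet_derivative (\<lambda>z. frechet_derivative G (at z) u) (at y) t *v w))) (at y)"
proof -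
  have "((\<lambda>z. frechet_derivative G (at z) u) has_derivative
      frechet_derivative (\<lambda>z. frechet_derivative G (at z) u) (at y)) (at y)"
    using C2_directional(2)[OF open_S C2 y] frechet_derivative_works by blast
  from bounded_linear.has_derivative[OF bounded_linear_matrix_form this]
  have "((\<lambda>z. v \<bullet> (frechet_derivative G (at z) u *v w)) has_derivative
    (\<lambda>t. v \<bullet> (frechet_derivative (\<lambda>z. frechet_derivative G (at z) u) (at y) t *v w))) (at y)" .
  then show ?thesis
    by (rule has_derivative_transform_within_open[OF _ open_S y]) (simp add: dB_eq)
qed

lemma dB_differentiable: "y \<in> S \<Longrightarrow> dB u v w differentiable (at y)"
  using dB_has_derivative unfolding differentiable_def by blast

lemma second_derivative_B_sym:
  assumes x: "x \<in> S"
  shows "frechet_derivative (dB u v w) (at x) t = frechet_derivative (dB t v w) (at x) u"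
proof -
  have dB: "(\<lambda>z. frechet_derivative (B v w) (at z) u) = dB u v w" for u by (simp add: dB_def[abs_def])
  have "isCont (\<lambda>y. frechet_derivative (dB u v w) (at y) t) x" for u t
  proof -
    let ?H = "\<lambda>y. frechet_derivative (\<lambda>z. frechet_derivative G (at z) u) (at y) t"
    have "isCont (\<lambda>y. v \<bullet> (?H y *v w)) x"
      by (rule bounded_linear.isCont[OF bounded_linear_matrix_form C2_directional(3)[OF open_S C2 x]])
    moreover have "frechet_derivative (dB u v w) (at y) t = v \<bullet> (?H y *v w)" if "y \<in> S" for y
      using frechet_derivative_at[OF dB_has_derivative[OF that]] by metis
    then have "\<forall>\<^sub>F y in nhds x. frechet_derivative (dB u v w) (at y) t = v \<bullet> (?H y *v w)"
      using open_S x eventually_nhds by blast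
    ultimately show ?thesis by (simp add: isCont_cong)
  qed
  then show ?thesis
    using second_derivative_symmetric[OF open_S x, of "B v w" u t] B_has_derivative dB_differentiable
    unfolding dB differentiable_def by blast
qed

lemma Gamma_differentiable:
  assumes y: "y \<in> S"
  shows "\<Gamma> u v differentiable (at y)"
proof -
  have "(\<lambda>z. G z $ i $ j) differentiable (at y)" for i j
    using B_has_derivative[OF y, of "axis i 1" "axis j 1"] 
    unfolding B_def[abs_def] inner_matrix_axis differentiable_def by blast
  moreover have "(\<lambda>z. koszul u v w z) differentiable (at y)" for w
    unfolding koszul_def using dB_differentiable[OF y] by auto
  ultimately have "(\<lambda>z. matrix_inv (G z) *v (\<chi> l. koszul u v (axis l 1) z)) differentiable (at y)"
    by (intro differentiable_linear_system_solution[OF open_S y]) (auto simp: inv)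
  then show ?thesis
    using differentiable_cong_open[OF open_S y Gamma_eq] by simp
qed

definition d\<Gamma> :: "real^'n \<Rightarrow> real^'n \<Rightarrow> real^'n \<Rightarrow> real^'n \<Rightarrow> real^'n"
  where "d\<Gamma> t u v y = frechet_derivative (\<Gamma> u v) (at y) t"

lemma Gamma_has_derivative: "y \<in> S \<Longrightarrow> (\<Gamma> u v has_derivative (\<lambda>t. d\<Gamma> t u v y)) (at y)"
  unfolding d\<Gamma>_def by (rule frechet_derivative_works[THEN iffD1, OF Gamma_differentiable])

lemma dGamma_linear:
  assumes y: "y \<in> S"
  shows "d\<Gamma> (a *\<^sub>R t + t') u v y = a *\<^sub>R d\<Gamma> t u v y + d\<Gamma> t' u v y"
    and "d\<Gamma> t (a *\<^sub>R u + u') v y = a *\<^sub>R d\<Gamma> t u v y + d\<Gamma> t u' v y"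
    and "d\<Gamma> t u (a *\<^sub>R v + v') y = a *\<^sub>R d\<Gamma> t u v y + d\<Gamma> t u v' y"
proof -
  have D: "(\<Gamma> u v has_derivative (\<lambda>t. d\<Gamma> t u v y)) (at y)" for u v
    by (rule Gamma_has_derivative[OF y])
  show "d\<Gamma> (a *\<^sub>R t + t') u v y = a *\<^sub>R d\<Gamma> t u v y + d\<Gamma> t' u v y"
  proof -
    have L: "linear (\<lambda>t. d\<Gamma> t u v y)" using D by (rule has_derivative_linear)
    show ?thesis using linear_add[OF L, of "a *\<^sub>R t" t'] linear_scale[OF L, of a t] by argo
  qed
  have "\<Gamma> (a *\<^sub>R u + u') v = (\<lambda>z. a *\<^sub>R \<Gamma> u v z + \<Gamma> u' v z)"
    "\<Gamma> u (a *\<^sub>R v + v') = (\<lambda>z. a *\<^sub>R \<Gamma> u v z + \<Gamma> u v' z)"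
    by (simp_all add: Gamma_linear fun_eq_iff)
  moreover have "frechet_derivative (\<lambda>z. a *\<^sub>R \<Gamma> p q z + \<Gamma> p' q' z) (at y) t = a *\<^sub>R d\<Gamma> t p q y + d\<Gamma> t p' q' y"
    for p q p' q'
    by (subst frechet_derivative_at[OF has_derivative_add[OF has_derivative_scaleR_right[OF D] D], symmetric])
      (rule refl)
  ultimately show "d\<Gamma> t (a *\<^sub>R u + u') v y = a *\<^sub>R d\<Gamma> t u v y + d\<Gamma> t u' v y"
    "d\<Gamma> t u (a *\<^sub>R v + v') y = a *\<^sub>R d\<Gamma> t u v y + d\<Gamma> t u v' y"
    by (simp_all add: d\<Gamma>_def)
qed

lemma dGamma_sym:
  assumes "y \<in> S"
  shows "d\<Gamma> t u v y = d\<Gamma> t v u y"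
proof -
  have "frechet_derivative (\<Gamma> u v) (at y) = frechet_derivative (\<Gamma> v u) (at y)"
    by (rule frechet_derivative_cong_open[OF open_S assms]) (rule Gamma_sym)
  then show ?thesis unfolding d\<Gamma>_def by (rule fun_cong)
qed

lemma curvature_op_constant_fields:
  "curvature_op G (\<lambda>_. u) (\<lambda>_. v) (\<lambda>_. w) x
    = d\<Gamma> u v w x + \<Gamma> u (\<Gamma> v w x) x - d\<Gamma> v u w x - \<Gamma> v (\<Gamma> u w x) x"
proof -
  have 1: "cov_deriv G (\<lambda>_. v) (\<lambda>_. w) = \<Gamma> v w" for v w
    by (simp add: fun_eq_iff cov_deriv_def \<Gamma>_def)
  have 2: "lie_bracket (\<lambda>_. u) (\<lambda>_. v) = (\<lambda>_. 0)"
    by (simp add: fun_eq_iff lie_bracket_def)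
  have 3: "cov_deriv G (\<lambda>_. u) (\<Gamma> v w) x = d\<Gamma> u v w x + \<Gamma> u (\<Gamma> v w x) x" for u v w
    unfolding cov_deriv_def d\<Gamma>_def \<Gamma>_def[of u "\<Gamma> v w x"] by (rule refl)
  have 4: "\<Gamma> 0 w x = 0"
    using Gamma_linear(1)[of 1 0 0 w x] by simp
  show ?thesis unfolding curvature_op_def 1 2 3 4 by simp
qed

definition curv :: "real^'n \<Rightarrow> real^'n \<Rightarrow> real^'n \<Rightarrow> real^'n \<Rightarrow> real^'n"
  where "curv u v w x = curvature_op G (\<lambda>_. u) (\<lambda>_. v) (\<lambda>_. w) x"

lemmas curv_eq = curv_def[unfolded curvature_op_constant_fields]

lemma curv_linear:
  assumes "x \<in> S"
  shows "curv (a *\<^sub>R u + u') v w x = a *\<^sub>R curv u v w x + curv u' v w x"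
    and "curv u v (a *\<^sub>R w + w') x = a *\<^sub>R curv u v w x + curv u v w' x"
  unfolding curv_eq Gamma_linear dGamma_linear[OF assms] by (simp_all add: algebra_simps)

lemma curv_skew: "curv u v w x = - curv v u w x"
  by (simp add: curv_eq)

text \<open>For constant fields the terms of the cyclic sum cancel in pairs, because \<open>\<Gamma>\<close> and its derivative are
  symmetric (the connection has no torsion).\<close>

lemma first_bianchi:
  assumes "x \<in> S"
  shows "curv u v w x + curv v w u x + curv w u v x = 0"
  unfolding curv_eq
  by (simp add: Gamma_sym[OF assms, of w u] Gamma_sym[OF assms, of w v] Gamma_sym[OF assms, of v u]
      dGamma_sym[OF assms, of _ w u] dGamma_sym[OF assms, of _ w v] dGamma_sym[OF assms, of _ v u])

lemma B_linear:
  "B (u + u') w x = B u w x + B u' w x" "B (u - u') w x = B u w x - B u' w x"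
  "B u (w + w') x = B u w x + B u w' x" "B u (w - w') x = B u w x - B u w' x"
  by (simp_all add: B_def inner_add_left inner_add_right inner_diff_left inner_diff_right
      matrix_vector_right_distrib matrix_vector_mult_diff_distrib)

text \<open>Differentiating \<open>\<partial>\<^sub>u g(v,w) = g(\<nabla>\<^sub>u v, w) + g(v, \<nabla>\<^sub>u w)\<close> once more, in the direction \<open>t\<close>. Compatibility with
  the metric is used again, for the derivative of the Gram matrix.\<close>

lemma second_derivative_B:
  assumes x: "x \<in> S"
  shows "frechet_derivative (dB u v w) (at x) t
    = B (d\<Gamma> t u v x) w x + B (\<Gamma> t (\<Gamma> u v x) x) w x + B (\<Gamma> u v x) (\<Gamma> t w x) x
      + B v (d\<Gamma> t u w x) x + B v (\<Gamma> t (\<Gamma> u w x) x) x + B (\<Gamma> t v x) (\<Gamma> u w x) x"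
proof -
  have G: "((\<lambda>z. G z *v w) has_derivative (\<lambda>t. frechet_derivative G (at x) t *v w)) (at x)" for w
  proof (rule bounded_linear.has_derivative[OF _ G_has_derivative[OF x]])
    show "bounded_linear (\<lambda>A::real^'n^'n. A *v w)"
      unfolding linear_conv_bounded_linear[symmetric]
      by (intro linearI) (simp_all add: matrix_vector_mult_add_rdistrib scaleR_matrix_vector_assoc)
  qed
  have D: "((\<lambda>z. B (\<Gamma> u v z) w z) has_derivative
      (\<lambda>t. B (\<Gamma> u v x) (\<Gamma> t w x) x + B (\<Gamma> t (\<Gamma> u v x) x) w x + B (d\<Gamma> t u v x) w x)) (at x)" for v w
  proof -
    have "((\<lambda>z. B (\<Gamma> u v z) w z) has_derivative
      (\<lambda>t. \<Gamma> u v x \<bullet> (frechet_derivative G (at x) t *v w) + d\<Gamma> t u v x \<bullet> (G x *v w))) (at x)"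
      unfolding B_def by (rule has_derivative_inner[OF Gamma_has_derivative[OF x] G])
    then show ?thesis
      unfolding dB_eq[OF x, symmetric] metric_compatible[OF x] B_def by (simp add: add_ac)
  qed
  have "((\<lambda>z. B (\<Gamma> u v z) w z + B (\<Gamma> u w z) v z) has_derivative
      (\<lambda>t. (B (\<Gamma> u v x) (\<Gamma> t w x) x + B (\<Gamma> t (\<Gamma> u v x) x) w x + B (d\<Gamma> t u v x) w x)
         + (B (\<Gamma> u w x) (\<Gamma> t v x) x + B (\<Gamma> t (\<Gamma> u w x) x) v x + B (d\<Gamma> t u w x) v x))) (at x)"
    by (rule has_derivative_add[OF D D])
  then have "(dB u v w has_derivative
      (\<lambda>t. (B (\<Gamma> u v x) (\<Gamma> t w x) x + B (\<Gamma> t (\<Gamma> u v x) x) w x + B (d\<Gamma> t u v x) w x)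
         + (B (\<Gamma> u w x) (\<Gamma> t v x) x + B (\<Gamma> t (\<Gamma> u w x) x) v x + B (d\<Gamma> t u w x) v x))) (at x)"
    by (rule has_derivative_transform_within_open[OF _ open_S x])
      (simp add: metric_compatible B_sym)
  from frechet_derivative_at[OF this, symmetric] show ?thesis
    by (simp add: B_sym[OF x, of v] B_sym[OF x, of "\<Gamma> t v x"])
qed

text \<open>Antisymmetrizing the second derivative of \<open>g(w,z)\<close> in its two directions kills the left-hand side by
  Schwarz's theorem and the products \<open>g(\<Gamma>(u,w), \<Gamma>(v,z))\<close> on the right; what remains is
  \<open>g(R(u,v)w, z) + g(w, R(u,v)z)\<close>.\<close>

lemma curv_metric_skew:
  assumes x: "x \<in> S"
  shows "B (curv u v w x) z x = - B w (curv u v z x) x"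
  using second_derivative_B_sym[OF x, of v w z u]
  unfolding second_derivative_B[OF x] curv_eq B_linear by simp

end

section \<open>Curvature tensor and Ricci tensor in a tangent space\<close>

text \<open>Adjointness with respect to \<open>A\<close> means that \<open>A\<close> conjugates \<open>h\<close> to the transpose of \<open>f\<close>, and traces are
  invariant under both operations. For an indefinite form this replaces traces in orthonormal frames.\<close>

lemma trace_matrix_adjoint:
  fixes f h :: "real^'n \<Rightarrow> real^'n" and A :: "real^'n^'n"
  assumes "linear f" "linear h" "invertible A" and adj: "\<And>x y. f x \<bullet> (A *v y) = x \<bullet> (A *v h y)"
  shows "trace (matrix f) = trace (matrix h)"
proof -
  obtain A' where A': "A ** A' = mat 1" "A' ** A = mat 1" using assms(3) invertible_def by blast
  have "x \<bullet> ((transpose (matrix f) ** A) *v y) = x \<bullet> ((A ** matrix h) *v y)" for x y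
  proof -
    have "matrix f *v x = f x" "matrix h *v y = h y"
      using assms(1,2) by (metis matrix_vector_mul(2))+
    moreover have "x \<bullet> (transpose (matrix f) *v (A *v y)) = (matrix f *v x) \<bullet> (A *v y)"
      using dot_lmul_matrix[of x "transpose (matrix f)" "A *v y"] by simp
    ultimately show ?thesis using adj[of x y] by (simp only: matrix_vector_mul_assoc[symmetric])
  qed
  then have "transpose (matrix f) ** A = A ** matrix h"
    by (metis matrix_eq vector_eq_ldot)
  then have "transpose (matrix f) = A ** (matrix h ** A')"
    by (metis A'(1) matrix_mul_assoc matrix_mul_rid)
  then have "trace (transpose (matrix f)) = trace (matrix h)"
    by (metis A'(2) matrix_mul_assoc matrix_mul_rid trace_mul_sym)
  then show ?thesis by (simp add: trace_def transpose_def)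
qed

text \<open>The algebraic properties of the Riemann tensor at one point from which all others follow. Everything up to
  the identity itself is linear algebra in one tangent space.\<close>

locale curvature_at_point =
  fixes g :: "('m, 'n::finite) metric_field" and c :: "('m, 'n) chart" and p :: 'm
  assumes g_sym: "transpose (g c p) = g c p" and g_inv: "invertible (g c p)"
    and Riem_linear1: "Riem g c p (s *\<^sub>R u + u') v w = s *\<^sub>R Riem g c p u v w + Riem g c p u' v w"
    and Riem_linear3: "Riem g c p u v (s *\<^sub>R w + w') = s *\<^sub>R Riem g c p u v w + Riem g c p u v w'"
    and Riem_skew: "Riem g c p u v w = - Riem g c p v u w"
    and Riem_bianchi: "Riem g c p u v w + Riem g c p v w u + Riem g c p w u v = 0"
    and Riem_metric_skew:
      "inner_g g c p (Riem g c p u v w) z = - inner_g g c p w (Riem g c p u v z)"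
begin

abbreviation "G \<equiv> inner_g g c p"
abbreviation "R \<equiv> Riem g c p"
abbreviation "S \<equiv> Ricci g c p"
abbreviation "Q \<equiv> Ricci_op g c p"
abbreviation "S2 \<equiv> Ricci_sq g c p"
abbreviation "r \<equiv> scalar_curv g c p"

lemma G_commute: "G u v = G v u"
  unfolding inner_g_def by (metis dot_lmul_matrix g_sym inner_commute vector_transpose_matrix)

lemma G_linear [simp]:
  "G (u + u') v = G u v + G u' v" "G (u - u') v = G u v - G u' v" "G (- u) v = - G u v"
  "G (s *\<^sub>R u) v = s * G u v" "G 0 v = 0"
  "G u (v + v') = G u v + G u v'" "G u (v - v') = G u v - G u v'" "G u (- v) = - G u v"
  "G u (s *\<^sub>R v) = s * G u v" "G u 0 = 0"
proof -
  show L: "G (u + u') v = G u v + G u' v" "G (u - u') v = G u v - G u' v" "G (- u) v = - G u v"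
    "G (s *\<^sub>R u) v = s * G u v" "G 0 v = 0" for u u' v s
    by (simp_all add: inner_g_def inner_add_left inner_diff_left)
  show "G u (v + v') = G u v + G u v'" "G u (v - v') = G u v - G u v'" "G u (- v) = - G u v"
  "G u (s *\<^sub>R v) = s * G u v" "G u 0 = 0"
    by (simp_all add: L G_commute[of u])
qed

lemma G_nondegenerate: "(\<And>z. G u z = G v z) \<Longrightarrow> u = v"
proof -
  assume "\<And>z. G u z = G v z"
  then have "\<And>z. u \<bullet> (g c p *v z) = v \<bullet> (g c p *v z)" by (simp add: inner_g_def)
  moreover obtain B where "g c p ** B = mat 1" using g_inv invertible_def by blast
  then have "g c p *v (B *v z) = z" for z by (simp add: matrix_vector_mul_assoc)
  ultimately show "u = v" by (metis vector_eq_rdot)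
qed

text \<open>The octahedron argument: add the first Bianchi identities for the four triples out of
  \<open>u, v, w, z\<close> with suitable signs.\<close>

lemma pair_symmetry: "G (R u v w) z = G (R w z u) v"
proof -
  have sk: "G (R a b d) e = - G (R b a d) e" for a b d e
    by (subst Riem_skew) simp
  have ms: "G (R a b d) e = - G (R a b e) d" for a b d e
    using Riem_metric_skew[of a b d e] G_commute by simp
  have bi: "G (R a b d) e + G (R b d a) e + G (R d a b) e = 0" for a b d e
    using arg_cong[OF Riem_bianchi[of a b d], of "\<lambda>x. G x e"] by simp
  show ?thesis
    using bi[of u v w z] bi[of v w z u] bi[of w z u v] bi[of z u v w]
      ms[of u v w z] ms[of v w u z] ms[of w z u v] ms[of z u v w]
      sk[of w u v z] ms[of u w v z] sk[of z v w u] ms[of v z w u]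
    by argo
qed

lemma linear_Riem: "linear (\<lambda>u. R u v w)" "linear (\<lambda>w. R u v w)"
proof -
  have lin: "linear f" if f: "\<And>s u u'. f (s *\<^sub>R u + u') = s *\<^sub>R f u + f u'"
    for f :: "real^'n \<Rightarrow> real^'n"
  proof (rule linearI)
    have "f 0 = 0" using f[of 1 0 0] by simp
    then show "f (u + u') = f u + f u'" "f (s *\<^sub>R u) = s *\<^sub>R f u" for s u u'
      using f[of 1 u u'] f[of s u 0] by simp_all
  qed
  show "linear (\<lambda>u. R u v w)"
    by (rule lin) (rule Riem_linear1)
  show "linear (\<lambda>w. R u v w)"
    by (rule lin) (rule Riem_linear3)
qed

text \<open>By the pair symmetry, \<open>x \<mapsto> R(x,v)w\<close> and \<open>y \<mapsto> R(y,w)v\<close> are adjoint with respect to \<open>g\<close>.\<close>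

lemma Ricci_commute: "S v w = S w v"
  unfolding Ricci_def
proof (rule trace_matrix_adjoint[OF linear_Riem(1) linear_Riem(1) g_inv])
  fix x y
  have "G (R x v w) y = G (R w y x) v" by (rule pair_symmetry)
  also have "\<dots> = - G x (R w y v)" by (rule Riem_metric_skew)
  also have "\<dots> = G x (R y w v)" by (subst Riem_skew) simp
  finally show "R x v w \<bullet> (g c p *v y) = x \<bullet> (g c p *v R y w v)" by (simp add: inner_g_def)
qed

lemma trace_matrix: "trace (matrix f) = (\<Sum>i\<in>UNIV. f (axis i 1) $ i)"
  for f :: "real^'n \<Rightarrow> real^'n"
  by (simp add: trace_def matrix_def)

lemma S_linear [simp]:
  "S u (v + v') = S u v + S u v'" "S u (v - v') = S u v - S u v'" "S u (s *\<^sub>R v) = s * S u v"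
  "S (u + u') v = S u v + S u' v" "S (u - u') v = S u v - S u' v" "S (s *\<^sub>R u) v = s * S u v"
proof -
  show L: "S u (v + v') = S u v + S u v'" "S u (v - v') = S u v - S u v'" "S u (s *\<^sub>R v) = s * S u v"
    for u v v' s
    by (simp_all add: Ricci_def trace_matrix linear_add[OF linear_Riem(2)] linear_diff[OF linear_Riem(2)]
        linear_scale[OF linear_Riem(2)] sum.distrib sum_subtractf sum_distrib_left)
  show "S (u + u') v = S u v + S u' v" "S (u - u') v = S u v - S u' v" "S (s *\<^sub>R u) v = s * S u v"
    by (simp_all add: L Ricci_commute[of _ v])
qed

lemma G_Ricci_op: "G (Q u) v = S u v"
proof -
  obtain B where B: "g c p ** B = mat 1" using g_inv invertible_def by blast
  define q where "q = B *v (\<chi> i. S u (axis i 1))"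
  have gq: "g c p *v q = (\<chi> i. S u (axis i 1))" by (simp add: q_def matrix_vector_mul_assoc B)
  have lin: "linear (S u)" by (intro linearI) simp_all
  have S: "S u v = (\<Sum>i\<in>UNIV. v $ i * S u (axis i 1))" for v
    using linear_basis_expansion[OF lin, of v] by simp
  have q: "G q v = S u v" for v
  proof -
    have "G v q = S u v" by (simp add: inner_g_def gq inner_vec_def S[of v])
    then show ?thesis by (simp add: G_commute[of q])
  qed
  have "Q u = q"
    unfolding Ricci_op_def
  proof (rule the_equality)
    show "\<forall>v. G q v = S u v" using q by blast
    show "q' = q" if "\<forall>v. G q' v = S u v" for q'
      using that q by (intro G_nondegenerate) simp
  qed
  then show ?thesis using q by simp
qed

lemma G_Ricci_op_right: "G u (Q v) = S u v"
  by (simp add: G_commute[of u] G_Ricci_op Ricci_commute)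

lemma Ricci_sq_commute: "S2 u v = S2 v u"
  unfolding Ricci_sq_def by (metis G_Ricci_op G_commute Ricci_commute)

lemma S_Ricci_op [simp]: "S (Q u) v = S2 u v" "S u (Q v) = S2 u v"
proof -
  show L: "S (Q u) v = S2 u v" for u v by (simp add: Ricci_sq_def)
  show "S u (Q v) = S2 u v" using L[of v u] by (simp add: Ricci_commute[of u] Ricci_sq_commute)
qed

end

section \<open>Consequences of the nullity condition\<close>

locale nullity_at_point = curvature_at_point g c p
  for g :: "('m, 'n::finite) metric_field" and c :: "('m, 'n) chart" and p :: 'm +
  fixes k \<epsilon> :: real and \<xi> :: "real^'n"
  assumes nullity: "\<xi> \<in> nullity g k c p" and G_xi_xi: "G \<xi> \<xi> = \<epsilon>" and eps: "\<epsilon> * \<epsilon> = 1"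
begin

text \<open>The eigenvalue of the Ricci operator at \<open>\<xi>\<close>.\<close>

definition N :: real where "N = k * (real CARD('n) - 1)"

lemma R_xi: "R x y \<xi> = k *\<^sub>R (G y \<xi> *\<^sub>R x - G x \<xi> *\<^sub>R y)"
  using nullity by (simp add: nullity_def)

lemma G_R_xi: "G (R u v w) \<xi> = k * (G u \<xi> * G v w - G v \<xi> * G u w)"
  unfolding Riem_metric_skew R_xi by (simp add: G_commute[of w] algebra_simps)

text \<open>The pair symmetry moves \<open>\<xi>\<close> from the last argument of the Riemann tensor, where the nullity condition
  speaks about it, to the first.\<close>

lemma R_xi_left: "R \<xi> x y = k *\<^sub>R (G x y *\<^sub>R \<xi> - G y \<xi> *\<^sub>R x)"
proof (rule G_nondegenerate)
  fix z
  have "G (R \<xi> x y) z = G (R y z \<xi>) x" by (rule pair_symmetry)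
  then show "G (R \<xi> x y) z = G (k *\<^sub>R (G x y *\<^sub>R \<xi> - G y \<xi> *\<^sub>R x)) z"
    unfolding R_xi by (simp add: G_commute algebra_simps)
qed

lemma S_xi: "S v \<xi> = N * G v \<xi>" "S \<xi> v = N * G v \<xi>"
proof -
  have "(\<Sum>i\<in>UNIV. G (axis i 1) \<xi> * v $ i) = G v \<xi>"
  proof -
    have lin: "linear (\<lambda>v. G v \<xi>)" by (intro linearI) simp_all
    show ?thesis using linear_basis_expansion[OF lin, of v] by (simp add: mult.commute)
  qed
  moreover have "S v \<xi> = (\<Sum>i\<in>UNIV. k * (G v \<xi> - G (axis i 1) \<xi> * v $ i))"
    unfolding Ricci_def trace_matrix R_xi by (simp add: axis_def)
  ultimately show "S v \<xi> = N * G v \<xi>"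
    by (simp add: N_def sum_distrib_left[symmetric] sum_subtractf algebra_simps)
  then show "S \<xi> v = N * G v \<xi>" by (simp add: Ricci_commute)
qed

lemma Q_xi: "Q \<xi> = N *\<^sub>R \<xi>"
  by (rule G_nondegenerate) (simp add: G_Ricci_op S_xi G_commute[of \<xi>])

abbreviation "T a \<equiv> T_curv a g c p"

text \<open>Once \<open>\<xi>\<close> fills the first slot, no Riemann tensor is left: the endomorphism is a combination of
  \<open>g(x,\<cdot>)\<xi>\<close>, \<open>g(\<xi>,\<cdot>)x\<close>, \<open>S(x,\<cdot>)\<xi>\<close>, \<open>g(\<xi>,\<cdot>)Qx\<close>, the identity and \<open>Q\<close>.\<close>

lemma T_xi_left:
  "T a \<xi> x y = ((k * a 0 + N * a 4 + a 7 * r) * G x y) *\<^sub>R \<xi>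
    + ((- k * a 0 + N * a 2 - a 7 * r) * G y \<xi>) *\<^sub>R x
    + (a 1 * S x y) *\<^sub>R \<xi> + (a 5 * G y \<xi>) *\<^sub>R Q x
    + (N * a 3 * G x \<xi>) *\<^sub>R y + (a 6 * G x \<xi>) *\<^sub>R Q y"
  by (simp add: T_curv_def R_xi_left Q_xi S_xi G_commute[of \<xi>] algebra_simps)

text \<open>Pairing with \<open>\<xi>\<close> removes the Riemann tensor as well: it is skew in its last pair, so \<open>\<xi>\<close> can be moved to
  the slot that the nullity condition is about.\<close>

lemma G_T_xi:
  "G (T b u v w) \<xi> = (k * b 0 + N * b 4 + b 7 * r) * G u \<xi> * G v w
    + (- k * b 0 + N * b 5 - b 7 * r) * G v \<xi> * G u w + N * b 6 * G w \<xi> * G u v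
    + b 1 * S v w * G u \<xi> + b 2 * S u w * G v \<xi> + b 3 * S u v * G w \<xi>"
  by (simp add: T_curv_def G_R_xi G_Ricci_op S_xi algebra_simps)

text \<open>Both sides of the pseudosymmetry condition are derivations by endomorphisms of the form in the
  assumption, so one computation serves for both. The trilinear form \<open>\<Phi>(u,v,w) = g(T(u,v)w, \<xi>)\<close> contains
  no Riemann tensor, and its multilinearity reduces the derivation to values of \<open>\<Phi>\<close> at \<open>\<xi>\<close>, \<open>x\<close>
  and images under \<open>Q\<close>. The only occurrences of the full tensor are the pairings with \<open>x\<close> in the terms
  with \<open>\<alpha>\<close> and \<open>\<gamma>\<close>.\<close>

lemma derivation_T_xi:
  fixes b u v w x
  defines "\<Phi> \<equiv> \<lambda>u v w. G (T b u v w) \<xi>"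
  assumes F: "\<And>y. F y = (\<alpha> * G x y) *\<^sub>R \<xi> + (\<beta> * G y \<xi>) *\<^sub>R x + (\<gamma> * S x y) *\<^sub>R \<xi> + (\<delta> * G y \<xi>) *\<^sub>R Q x
    + \<kappa> *\<^sub>R y + \<mu> *\<^sub>R Q y"
  shows "G (derivation_act F (T b) u v w) \<xi>
    = \<alpha> * (\<epsilon> * G x (T b u v w) - G x u * \<Phi> \<xi> v w - G x v * \<Phi> u \<xi> w - G x w * \<Phi> u v \<xi>)
    + \<beta> * (G x \<xi> * \<Phi> u v w - G u \<xi> * \<Phi> x v w - G v \<xi> * \<Phi> u x w - G w \<xi> * \<Phi> u v x)
    + \<gamma> * (\<epsilon> * S x (T b u v w) - S x u * \<Phi> \<xi> v w - S x v * \<Phi> u \<xi> w - S x w * \<Phi> u v \<xi>)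
    + \<delta> * (N * G x \<xi> * \<Phi> u v w - G u \<xi> * \<Phi> (Q x) v w - G v \<xi> * \<Phi> u (Q x) w - G w \<xi> * \<Phi> u v (Q x))
    - 2 * \<kappa> * \<Phi> u v w
    + \<mu> * (N * \<Phi> u v w - \<Phi> (Q u) v w - \<Phi> u (Q v) w - \<Phi> u v (Q w))"
proof -
  have \<Phi>_linear:
    "\<Phi> (y + y') v w = \<Phi> y v w + \<Phi> y' v w" "\<Phi> (s *\<^sub>R y) v w = s * \<Phi> y v w"
    "\<Phi> u (y + y') w = \<Phi> u y w + \<Phi> u y' w" "\<Phi> u (s *\<^sub>R y) w = s * \<Phi> u y w"
    "\<Phi> u v (y + y') = \<Phi> u v y + \<Phi> u v y'" "\<Phi> u v (s *\<^sub>R y) = s * \<Phi> u v y" for s y y' u v w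
    unfolding \<Phi>_def G_T_xi by (simp_all add: algebra_simps)
  have "G (derivation_act F (T b) u v w) \<xi>
    = G (F (T b u v w)) \<xi> - \<Phi> (F u) v w - \<Phi> u (F v) w - \<Phi> u v (F w)"
    by (simp add: derivation_act_def \<Phi>_def)
  also have "G (F (T b u v w)) \<xi> = \<alpha> * \<epsilon> * G x (T b u v w) + \<beta> * G x \<xi> * \<Phi> u v w
     + \<gamma> * \<epsilon> * S x (T b u v w) + \<delta> * N * G x \<xi> * \<Phi> u v w + \<kappa> * \<Phi> u v w + \<mu> * N * \<Phi> u v w"
    unfolding F by (simp add: G_xi_xi G_Ricci_op S_xi \<Phi>_def)
  finally show ?thesis unfolding F \<Phi>_linear by (simp add: algebra_simps)
qed

end

section \<open>The pseudosymmetry condition\<close>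

context nullity_at_point begin

lemma G_T_right:
  "G x (T b u v w) = b 0 * G (R u v w) x + b 1 * S v w * G x u + b 2 * S u w * G x v + b 3 * S u v * G x w
    + b 4 * G v w * S x u + b 5 * G u w * S x v + b 6 * G u v * S x w
    + b 7 * r * (G v w * G x u - G u w * G x v)"
  by (simp add: T_curv_def G_Ricci_op_right G_commute[of x "R u v w"])

lemma S_T_right:
  "S x (T b u v w) = b 0 * S x (R u v w) + b 1 * S v w * S x u + b 2 * S u w * S x v + b 3 * S u v * S x w
    + b 4 * G v w * S2 x u + b 5 * G u w * S2 x v + b 6 * G u v * S2 x w
    + b 7 * r * (G v w * S x u - G u w * S x v)"
  by (simp add: T_curv_def)

text \<open>The identity at one point: insert \<open>\<xi>\<close> and \<open>x\<close> in the two derivation slots of the pseudosymmetry condition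
  and take the inner product with \<open>\<xi>\<close>. The rest is comparison of coefficients, with \<open>g(y,\<xi>) = \<epsilon> \<eta>(y)\<close>
  and \<open>\<epsilon>\<^sup>2 = 1\<close>. The form \<open>\<eta>\<close> and the number \<open>m = n - 1\<close> are kept as units, so that the polynomials stay small.\<close>

lemma pseudosymmetric_at_xi:
  fixes a b :: "nat \<Rightarrow> real" and L :: real
  defines "m \<equiv> real CARD('n) - 1" and "\<eta> \<equiv> \<lambda>y. \<epsilon> * G y \<xi>"
  assumes pseudo: "derivation_act (T a \<xi> x) (T b) u v w = L *\<^sub>R Q_tensor G (T b) u v w \<xi> x"
  shows "\<epsilon> * b 0 * (k * a 0 + k * m * a 4 + a 7 * r) * G (R u v w) x
        + \<epsilon> * a 1 * b 0 * S x (R u v w)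
        - 2 * k * m * a 3 * (k * b 0 + k * m * b 4 + b 7 * r) * \<eta> x * \<eta> u * G v w
        - 2 * k * m * a 3 * (- k * b 0 + k * m * b 5 - b 7 * r) * \<eta> x * \<eta> v * G u w
        + \<epsilon> * a 1 * b 4 * S2 x u * G v w + \<epsilon> * a 1 * b 5 * S2 x v * G u w
        + \<epsilon> * a 1 * b 6 * S2 x w * G u v
        - a 5 * (b 1 + b 3) * S2 x v * \<eta> u * \<eta> w
        - a 5 * (b 1 + b 2) * S2 x w * \<eta> u * \<eta> v
        - a 5 * (b 2 + b 3) * S2 x u * \<eta> v * \<eta> w
        - 2 * a 6 * b 1 * S2 v w * \<eta> x * \<eta> u - 2 * a 6 * b 2 * S2 u w * \<eta> x * \<eta> v
        - 2 * a 6 * b 3 * S2 u v * \<eta> x * \<eta> w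
        - 2 * k^2 * m^2 * a 3 * b 6 * G u v * \<eta> x * \<eta> w
        - 2 * (k * m * a 3 * b 1 + a 6 * (k * b 0 + k * m * b 4 + b 7 * r))
            * \<eta> x * \<eta> u * S v w
        - 2 * (k * m * a 3 * b 2 + a 6 * (- k * b 0 + k * m * b 5 - b 7 * r))
            * \<eta> x * \<eta> v * S u w
        - 2 * k * m * (a 3 * b 3 + a 6 * b 6) * S u v * \<eta> x * \<eta> w
        + \<epsilon> * (b 4 * (k * a 0 + k * m * a 4 + a 7 * r) - a 1 * (k * b 0 + k * m * b 4))
            * S x u * G v w
        + \<epsilon> * (b 5 * (k * a 0 + k * m * a 4 + a 7 * r) - a 1 * (- k * b 0 + k * m * b 5))
            * S x v * G u w
        + \<epsilon> * b 6 * (k * a 0 + k * m * (a 4 - a 1) + a 7 * r) * S x w * G u v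
        - \<epsilon> * (k * b 0 + k * m * b 4) * (k * a 0 + k * m * a 4 + a 7 * r)
            * G x u * G v w
        - \<epsilon> * (- k * b 0 + k * m * b 5) * (k * a 0 + k * m * a 4 + a 7 * r)
            * G u w * G x v
        - \<epsilon> * k * m * b 6 * (k * a 0 + k * m * a 4 + a 7 * r) * G x w * G u v
        - k * m * ((b 2 + b 3) * (k * a 0 + k * m * a 4 + a 7 * r)
            + (a 2 + a 4) * (- k * b 0 + k * m * (b 5 + b 6) - b 7 * r)) * G x u * \<eta> v * \<eta> w
        - k * m * ((b 1 + b 3) * (k * a 0 + k * m * a 4 + a 7 * r)
            + (a 2 + a 4) * (k * b 0 + k * m * (b 4 + b 6) + b 7 * r)) * G x v * \<eta> u * \<eta> w
        - ((b 1 + b 3) * (- k * a 0 + k * m * (a 1 + a 2) - a 7 * r)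
            + (a 1 + a 5) * (k * b 0 + k * m * (b 4 + b 6) + b 7 * r)) * S x v * \<eta> u * \<eta> w
        - ((b 2 + b 3) * (- k * a 0 + k * m * (a 1 + a 2) - a 7 * r)
            + (a 1 + a 5) * (- k * b 0 + k * m * (b 5 + b 6) - b 7 * r)) * S x u * \<eta> v * \<eta> w
        - ((b 1 + b 2) * (- k * a 0 + k * m * (a 1 + a 2) - a 7 * r)
            + k * m * (b 4 + b 5) * (a 1 + a 5)) * S x w * \<eta> u * \<eta> v
        - k * m * (k * m * (b 4 + b 5) * (a 2 + a 4)
            + (b 1 + b 2) * (k * a 0 + k * m * a 4 + a 7 * r)) * G x w * \<eta> u * \<eta> v
   = L *
     (\<epsilon> * b 0 * G (R u v w) x + \<epsilon> * b 4 * S x u * G v w + \<epsilon> * b 5 * S x v * G u w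
          + \<epsilon> * b 6 * S x w * G u v
          - \<epsilon> * k * m * b 6 * G u v * G x w
          - k * m * (b 2 + b 3) * G x u * \<eta> v * \<eta> w
          - k * m * (b 1 + b 3) * G x v * \<eta> u * \<eta> w
          - k * m * (b 1 + b 2) * G x w * \<eta> u * \<eta> v
          + (b 2 + b 3) * S x u * \<eta> v * \<eta> w + (b 1 + b 3) * S x v * \<eta> u * \<eta> w
          + (b 1 + b 2) * S x w * \<eta> u * \<eta> v
          - \<epsilon> * (- k * b 0 + k * m * b 5) * G u w * G x v
          - \<epsilon> * (k * b 0 + k * m * b 4) * G v w * G x u)" (is "?lhs = L * ?rhs")
proof -
  have N: "N = k * m" by (simp add: N_def m_def)
  have eta: "G y \<xi> = \<epsilon> * \<eta> y" for y using eps by (simp add: \<eta>_def mult.assoc[symmetric])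
  have eps': "\<epsilon> * (\<epsilon> * z) = z" for z using eps by (simp add: mult.assoc[symmetric])
  note comm = G_commute[of u x] G_commute[of v x] G_commute[of w x]
    Ricci_commute[of u x] Ricci_commute[of v x] Ricci_commute[of w x]
    Ricci_sq_commute[of u x] Ricci_sq_commute[of v x] Ricci_sq_commute[of w x]
    G_commute[of \<xi> u] G_commute[of \<xi> v] G_commute[of \<xi> w] G_commute[of \<xi> x]
  note expand = G_T_xi G_T_right S_T_right G_xi_xi S_xi S_Ricci_op G_Ricci_op G_Ricci_op_right comm
  have F: "T a \<xi> x y = ((k * a 0 + N * a 4 + a 7 * r) * G x y) *\<^sub>R \<xi>
    + ((- k * a 0 + N * a 2 - a 7 * r) * G y \<xi>) *\<^sub>R x
    + (a 1 * S x y) *\<^sub>R \<xi> + (a 5 * G y \<xi>) *\<^sub>R Q x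
    + (N * a 3 * G x \<xi>) *\<^sub>R y + (a 6 * G x \<xi>) *\<^sub>R Q y" for y by (rule T_xi_left)
  \<comment> \<open>\<open>\<xi> \<and>\<^sub>g x\<close> is the case \<open>\<alpha> = 1\<close>, \<open>\<beta> = -1\<close> of the same family of endomorphisms.\<close>
  have W: "wedge_op G \<xi> x y = (1 * G x y) *\<^sub>R \<xi> + (-1 * G y \<xi>) *\<^sub>R x + (0 * S x y) *\<^sub>R \<xi>
    + (0 * G y \<xi>) *\<^sub>R Q x + 0 *\<^sub>R y + 0 *\<^sub>R Q y" for y
    by (simp add: wedge_op_def G_commute[of \<xi>])
  have "?rhs = G (Q_tensor G (T b) u v w \<xi> x) \<xi>"
    unfolding Q_tensor_def derivation_T_xi[OF W] expand
    unfolding N eta by (simp add: algebra_simps eps eps')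
  moreover have "?lhs = G (derivation_act (T a \<xi> x) (T b) u v w) \<xi>"
    unfolding derivation_T_xi[OF F] expand
    unfolding N eta by (simp add: algebra_simps power2_eq_square eps eps')
  ultimately show ?thesis unfolding pseudo by simp
qed

end

section \<open>From charts to tangent spaces\<close>

lemma coord_rep_at:
  assumes c: "is_chart M c" and q: "q \<in> fst c"
  shows "coord_rep c f (snd c q) = f q"
proof -
  have "topspace (subtopology M (fst c)) = fst c"
    using c by (intro topspace_subtopology_subset openin_subset) (simp add: is_chart_def)
  moreover have "homeomorphic_map (subtopology M (fst c)) (top_of_set (coord_range c)) (snd c)"
    using c by (simp add: is_chart_def)
  ultimately have "inj_on (snd c) (fst c)" using homeomorphic_imp_injective_map by metis
  then show ?thesis using q by (simp add: coord_rep_def inv_into_f_f)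
qed

lemma local_metric_chart:
  assumes M: "semi_riemannian_manifold M A g" and c: "c \<in> A"
  shows "local_metric (coord_rep c (g c)) (coord_range c)"
proof -
  have metric: "semi_riemannian_metric A g" and chart: "is_chart M c"
    using M c by (simp_all add: semi_riemannian_manifold_def smooth_manifold_def)
  note at = coord_rep_at[OF chart]
  have sym: "transpose (g c q) = g c q" if "q \<in> fst c" for q
    using metric c that unfolding semi_riemannian_metric_def by blast
  have inv: "invertible (g c q)" if q: "q \<in> fst c" for q
  proof -
    have "u = 0" if "g c q *v u = 0" for u
    proof -
      have "inner_g g c q u v = 0" for v
        using dot_lmul_matrix[of u "g c q" v] vector_transpose_matrix[of u "g c q"] sym[OF q] that
        by (simp add: inner_g_def)
      then show ?thesis using metric c q unfolding semi_riemannian_metric_def by blast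
    qed
    then show ?thesis
      unfolding invertible_left_inverse using matrix_left_invertible_ker[of "g c q"] by blast
  qed
  show ?thesis
  proof
    show "open (coord_range c)" using chart by (simp add: is_chart_def)
    show "Ck_on 2 (coord_range c) (coord_rep c (g c))"
      using metric c unfolding semi_riemannian_metric_def smooth_on_def by blast
    show "transpose (coord_rep c (g c) y) = coord_rep c (g c) y" "invertible (coord_rep c (g c) y)"
      if "y \<in> coord_range c" for y
      using that by (auto simp: coord_range_def at sym inv)
  qed
qed

text \<open>The Riemann tensor at \<open>p\<close> is the curvature of the coordinate representation of the metric, evaluated on
  constant fields, so it inherits the symmetries of the Levi-Civita curvature of a local metric.\<close>

lemma curvature_at_point_manifold:
  assumes M: "semi_riemannian_manifold M A g" and c: "c \<in> A" and p: "p \<in> fst c"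
  shows "curvature_at_point g c p"
proof -
  interpret local_metric "coord_rep c (g c)" "coord_range c"
    using M c by (rule local_metric_chart)
  have x: "snd c p \<in> coord_range c" using p by (simp add: coord_range_def)
  have "is_chart M c" using M c by (simp add: semi_riemannian_manifold_def smooth_manifold_def)
  then have at: "coord_rep c (g c) (snd c p) = g c p" using p by (rule coord_rep_at)
  have R: "Riem g c p u v w = curv u v w (snd c p)" for u v w
    by (simp add: Riem_def curv_def)
  have G: "inner_g g c p v w = B v w (snd c p)" for v w
    by (simp add: inner_g_def B_def at)
  show ?thesis
  proof
    show "transpose (g c p) = g c p" "invertible (g c p)" using sym[OF x] inv[OF x] by (simp_all only: at)
  qed (unfold R G, (rule curv_linear[OF x] curv_skew first_bianchi[OF x] curv_metric_skew[OF x])+)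
qed

theorem theorem4p2:
  fixes M :: "'m topology" and A :: "('m, 'n::finite) chart set"
    and g :: "('m, 'n) metric_field" and \<xi> :: "('m, 'n) vfield"
    and k \<epsilon> :: real and a b :: "nat \<Rightarrow> real" and L :: "'m \<Rightarrow> real"
  assumes "Nk_semi_riemannian_manifold M A g k \<xi> \<epsilon>"
    and "Ta_Tb_pseudosymmetric A g a b L"
  shows "\<forall>U V W X. smooth_vector_field A U \<and> smooth_vector_field A V \<and>
      smooth_vector_field A W \<and> smooth_vector_field A X \<longrightarrow>
    (\<forall>c\<in>A. \<forall>p\<in>fst c.
     (let n = real CARD('n); u = U c p; v = V c p; w = W c p; x = X c p;
        G = inner_g g c p; R = Riem g c p; S = Ricci g c p; S2 = Ricci_sq g c p;
        r = scalar_curv g c p; \<eta> = eta_form g \<xi> \<epsilon> c p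
      in
        \<epsilon> * b 0 * (k * a 0 + k * (n-1) * a 4 + a 7 * r) * G (R u v w) x
        + \<epsilon> * a 1 * b 0 * S x (R u v w)
        - 2 * k * (n-1) * a 3 * (k * b 0 + k * (n-1) * b 4 + b 7 * r) * \<eta> x * \<eta> u * G v w
        - 2 * k * (n-1) * a 3 * (- k * b 0 + k * (n-1) * b 5 - b 7 * r) * \<eta> x * \<eta> v * G u w
        + \<epsilon> * a 1 * b 4 * S2 x u * G v w + \<epsilon> * a 1 * b 5 * S2 x v * G u w
        + \<epsilon> * a 1 * b 6 * S2 x w * G u v
        - a 5 * (b 1 + b 3) * S2 x v * \<eta> u * \<eta> w
        - a 5 * (b 1 + b 2) * S2 x w * \<eta> u * \<eta> v
        - a 5 * (b 2 + b 3) * S2 x u * \<eta> v * \<eta> w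
        - 2 * a 6 * b 1 * S2 v w * \<eta> x * \<eta> u - 2 * a 6 * b 2 * S2 u w * \<eta> x * \<eta> v
        - 2 * a 6 * b 3 * S2 u v * \<eta> x * \<eta> w
        - 2 * k^2 * (n-1)^2 * a 3 * b 6 * G u v * \<eta> x * \<eta> w
        - 2 * (k * (n-1) * a 3 * b 1 + a 6 * (k * b 0 + k * (n-1) * b 4 + b 7 * r))
            * \<eta> x * \<eta> u * S v w
        - 2 * (k * (n-1) * a 3 * b 2 + a 6 * (- k * b 0 + k * (n-1) * b 5 - b 7 * r))
            * \<eta> x * \<eta> v * S u w
        - 2 * k * (n-1) * (a 3 * b 3 + a 6 * b 6) * S u v * \<eta> x * \<eta> w
        + \<epsilon> * (b 4 * (k * a 0 + k * (n-1) * a 4 + a 7 * r) - a 1 * (k * b 0 + k * (n-1) * b 4))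
            * S x u * G v w
        + \<epsilon> * (b 5 * (k * a 0 + k * (n-1) * a 4 + a 7 * r) - a 1 * (- k * b 0 + k * (n-1) * b 5))
            * S x v * G u w
        + \<epsilon> * b 6 * (k * a 0 + k * (n-1) * (a 4 - a 1) + a 7 * r) * S x w * G u v
        - \<epsilon> * (k * b 0 + k * (n-1) * b 4) * (k * a 0 + k * (n-1) * a 4 + a 7 * r)
            * G x u * G v w
        - \<epsilon> * (- k * b 0 + k * (n-1) * b 5) * (k * a 0 + k * (n-1) * a 4 + a 7 * r)
            * G u w * G x v
        - \<epsilon> * k * (n-1) * b 6 * (k * a 0 + k * (n-1) * a 4 + a 7 * r) * G x w * G u v
        - k * (n-1) * ((b 2 + b 3) * (k * a 0 + k * (n-1) * a 4 + a 7 * r)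
            + (a 2 + a 4) * (- k * b 0 + k * (n-1) * (b 5 + b 6) - b 7 * r)) * G x u * \<eta> v * \<eta> w
        - k * (n-1) * ((b 1 + b 3) * (k * a 0 + k * (n-1) * a 4 + a 7 * r)
            + (a 2 + a 4) * (k * b 0 + k * (n-1) * (b 4 + b 6) + b 7 * r)) * G x v * \<eta> u * \<eta> w
        - ((b 1 + b 3) * (- k * a 0 + k * (n-1) * (a 1 + a 2) - a 7 * r)
            + (a 1 + a 5) * (k * b 0 + k * (n-1) * (b 4 + b 6) + b 7 * r)) * S x v * \<eta> u * \<eta> w
        - ((b 2 + b 3) * (- k * a 0 + k * (n-1) * (a 1 + a 2) - a 7 * r)
            + (a 1 + a 5) * (- k * b 0 + k * (n-1) * (b 5 + b 6) - b 7 * r)) * S x u * \<eta> v * \<eta> w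
        - ((b 1 + b 2) * (- k * a 0 + k * (n-1) * (a 1 + a 2) - a 7 * r)
            + k * (n-1) * (b 4 + b 5) * (a 1 + a 5)) * S x w * \<eta> u * \<eta> v
        - k * (n-1) * (k * (n-1) * (b 4 + b 5) * (a 2 + a 4)
            + (b 1 + b 2) * (k * a 0 + k * (n-1) * a 4 + a 7 * r)) * G x w * \<eta> u * \<eta> v
      = L p *
         (\<epsilon> * b 0 * G (R u v w) x + \<epsilon> * b 4 * S x u * G v w + \<epsilon> * b 5 * S x v * G u w
          + \<epsilon> * b 6 * S x w * G u v
          - \<epsilon> * k * (n-1) * b 6 * G u v * G x w
          - k * (n-1) * (b 2 + b 3) * G x u * \<eta> v * \<eta> w
          - k * (n-1) * (b 1 + b 3) * G x v * \<eta> u * \<eta> w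
          - k * (n-1) * (b 1 + b 2) * G x w * \<eta> u * \<eta> v
          + (b 2 + b 3) * S x u * \<eta> v * \<eta> w + (b 1 + b 3) * S x v * \<eta> u * \<eta> w
          + (b 1 + b 2) * S x w * \<eta> u * \<eta> v
          - \<epsilon> * (- k * b 0 + k * (n-1) * b 5) * G u w * G x v
          - \<epsilon> * (k * b 0 + k * (n-1) * b 4) * G v w * G x u)))"
proof (intro allI impI ballI, goal_cases)
  case (1 U V W X c p)
  then have c: "c \<in> A" and p: "p \<in> fst c" by simp_all
  have M: "semi_riemannian_manifold M A g" and eps: "\<epsilon> \<in> {1, -1}"
    and xi: "inner_g g c p (\<xi> c p) (\<xi> c p) = \<epsilon>" "\<xi> c p \<in> nullity g k c p"
    using assms(1) c p by (simp_all only: Nk_semi_riemannian_manifold_def)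
  interpret curvature_at_point g c p
    using M c p by (rule curvature_at_point_manifold)
  interpret nullity_at_point g c p k \<epsilon> "\<xi> c p"
    using xi eps by unfold_locales auto
  have pseudo: "derivation_act (T a (\<xi> c p) (X c p)) (T b) (U c p) (V c p) (W c p)
      = L p *\<^sub>R Q_tensor G (T b) (U c p) (V c p) (W c p) (\<xi> c p) (X c p)"
    using assms(2) c p by (simp only: Ta_Tb_pseudosymmetric_def)
  show ?case
    unfolding Let_def eta_form_def by (rule pseudosymmetric_at_xi[OF pseudo])
qed

end
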